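(* Let $D=(P_1,\dots,P_n)$ be a sequence of $n$ points $P_i=(\alpha_i,\beta_i)\in\mathbb N\times\mathbb N$, not necessarily distinct, such that the numbers $s_i=\alpha_i+\beta_i$ are weakly increasing in $i$, and put $d=\sum_i s_i$. Let $S$ be a staircase form of $D$ and $B(S)$ its block diagonal form. Suppose the last block of $B(S)$ has size $t_0$ and contains $j_r$ nonzero entries above the diagonal. Suppose the first $j_r+2$ blocks of $B(S)$ are of size $1$, i.e. $s_i=i-1$ for $1\le i\le j_r+3$. Suppose $P_2=(1,0)$. Let $t$ be an integer with $1\le t\le t_0$, and suppose $\alpha_{n-t+1}\ge1$ and $\beta_{n-t+1}\ge 1$. Let $$D^{\nwarrow}=(P_1,\dots,P_{j_r+1},P_{j_r+2}+(1,-1),P_{j_r+3},\dots,P_{n-t},P_{n-t+1}+(-1,1),P_{n-t+2},\dots,P_n),$$ $$D^{\searrow}=(P_1,(0,1),P_3,\dots,P_{n-t},P_{n-t+1}+(1,-1),P_{n-t+2},\dots,P_n).$$ (a) If $\beta_{j_r+2}\ge 1$ (so that $D^{\nwarrow}$ consists of points of $\mathbb N\times\mathbb N$), then $2\Delta(D)\sim\Delta(D^{\nwarrow})+\Delta(D^{\searrow})$ modulo $I_{<d}$ and staircase forms of lower partition types. (b) Moreover, if the last block of $B(S)$ is not minimal, or if $s_{n-t+1}>n-t_0$, then $\Delta(D)\sim\Delta(D^{\searrow})$ modulo $I_{<d}$ and staircase forms of lower partition types. Here "$f\sim g$ modulo $I_{<d}$ and staircase forms of lower partition types" means that $f-g$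 lies in the ideal generated by $I_{<d}$ and all determinants of nonzero staircase forms whose partition type is $<_P$ the partition type of $D$.
   Context: $\mathbb N$ is the set of nonnegative integers. $I=\bigcap_{1\le i<j\le n}(x_i-x_j,\,y_i-y_j)\subset\mathbb C[x_1,y_1,\dots,x_n,y_n]$, and $I_{<d}$ is the ideal generated by the homogeneous elements of $I$ of degree less than $d$. For a sequence $D$ of $n$ points $(\alpha_j,\beta_j)\in\mathbb N\times\mathbb N$, $\Delta(D)=\det\big[x_i^{\alpha_j}y_i^{\beta_j}\big]_{1\le i,j\le n}$ (columns in the order of the sequence). Staircase form. Let $D$ be a sequence of $n$ points $(\alpha_j,\beta_j)\in\mathbb N\times\mathbb N$, not necessarily distinct, with $s_j=\alpha_j+\beta_j$ weakly increasing and $d=\sum_j s_j$. A staircase form of $D$ is an $n\times n$ matrix $S$ (or, by abuse of language, its determinant) whose $(i,j)$ entry is $0$ if $i\le s_j$, and otherwise is a product $a_{i1}a_{i2}\cdots a_{i,s_j}$ in which each factor $a_{i\ell}$ is either $x_i-x_\ell$ or $y_i-y_\ell$ (the choice may depend on the column $j$), and such that $\det S-\Delta(D)\in I_{<d}$. It is called nonzero if its determinant is nonzero. Block diagonal form. Let $\{j:s_j=j-1\}=\{r_1<\dots<r_\ell\}$ and $r_{\ell+1}=n+1$. The $t$-th block $B_t$ of $S$ is the square submatrix of consecutive rows and columns of $S$ of size $r_{t+1}-r_t$ whose upper-left corner is the $(r_t,r_t)$ entry; $B(S)=\mathrm{diag}(B_1,\dots,B_\ell)$. Partition type. The partition type of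 $S$ (or of $D$) is the partition formed by the positive numbers among the numbers of nonzero entries above the diagonal in the blocks of $B(S)$; it depends only on $(s_1,\dots,s_n)$ and is a partition of $\frac{n(n-1)}2-d$. A block is minimal if the $(i,j)$ entry (in the indexing of $S$) is zero whenever $j>i+1$. Order on partitions. For partitions $\mu,\nu$ of the same integer, $\mu<_P\nu$ means $\mu\ne\nu$ and the parts of $\mu$ can be grouped into disjoint groups whose sums are precisely the parts of $\nu$; "lower partition type" refers to this order. *)

theory Defs
  imports
    "HOL-Library.Poly_Mapping"
    "HOL-Algebra.Ideal"
    "Jordan_Normal_Form.Determinant"
begin

text \<open>
  All indices are shifted to start at 0: the points of a sequence are D!0, ..., D!(n-1), matrices
  have rows and columns 0, ..., n-1, and the variables of C[x_1,y_1,...,x_n,y_n] are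
  \<open>XV i\<close>, \<open>YV i\<close> with \<open>i < n\<close>.
\<close>

subsection \<open>The polynomial ring and its ideals\<close>

datatype xyvar = XV nat | YV nat

text \<open>Polynomials over the complex numbers in countably many variables; a monomial is its
  exponent function.\<close>

type_synonym xypoly = "(xyvar \<Rightarrow>\<^sub>0 nat) \<Rightarrow>\<^sub>0 complex"

definition xvar :: "nat \<Rightarrow> xypoly" where
  "xvar i = Poly_Mapping.single (Poly_Mapping.single (XV i) 1) 1"

definition yvar :: "nat \<Rightarrow> xypoly" where
  "yvar i = Poly_Mapping.single (Poly_Mapping.single (YV i) 1) 1"

definition xy_ring :: "nat \<Rightarrow> xypoly ring" where
  "xy_ring n = \<lparr>carrier = {p. \<forall>m\<in>Poly_Mapping.keys p. Poly_Mapping.keys m \<subseteq> XV ` {..<n} \<union> YV ` {..<n}},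
     monoid.mult = (*), one = 1, zero = 0, add = (+)\<rparr>"

definition homogeneous :: "nat \<Rightarrow> xypoly \<Rightarrow> bool" where
  "homogeneous k p \<longleftrightarrow> (\<forall>m\<in>Poly_Mapping.keys p. (\<Sum>v\<in>Poly_Mapping.keys m. Poly_Mapping.lookup m v) = k)"

definition diagonal_ideal :: "nat \<Rightarrow> xypoly set" where
  "diagonal_ideal n = {f \<in> carrier (xy_ring n). \<forall>i j. i < j \<and> j < n \<longrightarrow>
     f \<in> genideal (xy_ring n) {xvar i - xvar j, yvar i - yvar j}}"

definition low_degree_ideal :: "nat \<Rightarrow> nat \<Rightarrow> xypoly set" where
  "low_degree_ideal n d =
     genideal (xy_ring n) {f \<in> diagonal_ideal n. \<exists>k<d. homogeneous k f}"

subsection \<open>Alternants and staircase forms\<close>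

definition pt_deg :: "nat \<times> nat \<Rightarrow> nat" where
  "pt_deg p = fst p + snd p"

definition total_deg :: "(nat \<times> nat) list \<Rightarrow> nat" where
  "total_deg D = sum_list (map pt_deg D)"

definition Delta :: "(nat \<times> nat) list \<Rightarrow> xypoly" where
  "Delta D = det (mat (length D) (length D)
     (\<lambda>(i, j). xvar i ^ fst (D ! j) * yvar i ^ snd (D ! j)))"

text \<open>\<open>c i j l\<close> records whether the factor with index \<open>l\<close> of the \<open>(i, j)\<close> entry is a
  difference of x-variables or of y-variables. In the 1-based indexing, the vanishing condition
  reads \<open>i \<le> s_j\<close>.\<close>

definition staircase_form :: "(nat \<times> nat) list \<Rightarrow> xypoly mat \<Rightarrow> bool" where
  "staircase_form D S \<longleftrightarrow>
     sorted (map pt_deg D) \<and>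
     S \<in> carrier_mat (length D) (length D) \<and>
     (\<exists>c :: nat \<Rightarrow> nat \<Rightarrow> nat \<Rightarrow> bool. \<forall>i < length D. \<forall>j < length D.
        S $$ (i, j) =
          (if i < pt_deg (D ! j) then 0
           else \<Prod>l < pt_deg (D ! j). if c i j l then xvar i - xvar l else yvar i - yvar l)) \<and>
     det S - Delta D \<in> low_degree_ideal (length D) (total_deg D)"

subsection \<open>Blocks and partition types\<close>

definition block_starts :: "(nat \<times> nat) list \<Rightarrow> nat list" where
  "block_starts D = filter (\<lambda>j. pt_deg (D ! j) = j) [0..<length D]"

text \<open>The list of diagonal blocks of the block diagonal form; each start is paired with the next
  start, and the last one with \<open>length D\<close>.\<close>

definition blocks :: "(nat \<times> nat) list \<Rightarrow> xypoly mat \<Rightarrow> xypoly mat list" where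
  "blocks D S =
     map (\<lambda>(r, r'). mat (r' - r) (r' - r) (\<lambda>(i, j). S $$ (r + i, r + j)))
       (zip (block_starts D) (tl (block_starts D) @ [length D]))"

definition block_diagonal_form :: "(nat \<times> nat) list \<Rightarrow> xypoly mat \<Rightarrow> xypoly mat" where
  "block_diagonal_form D S = diag_block_mat (blocks D S)"

definition nonzeros_above_diag :: "xypoly mat \<Rightarrow> nat" where
  "nonzeros_above_diag B =
     card {(i, j). i < dim_row B \<and> j < dim_col B \<and> i < j \<and> B $$ (i, j) \<noteq> 0}"

definition minimal_block :: "xypoly mat \<Rightarrow> bool" where
  "minimal_block B \<longleftrightarrow>
     (\<forall>i < dim_row B. \<forall>j < dim_col B. i + 1 < j \<longrightarrow> B $$ (i, j) = 0)"

text \<open>Partitions are represented by the multiset of their (positive) parts.\<close>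

definition partition_type :: "(nat \<times> nat) list \<Rightarrow> xypoly mat \<Rightarrow> nat multiset" where
  "partition_type D S =
     filter_mset (\<lambda>k. 0 < k) (mset (map nonzeros_above_diag (blocks D S)))"

text \<open>\<open>G\<close> is the multiset of groups. The groups use up all parts of \<open>\<mu>\<close>, as they must when
  \<open>\<mu>\<close> and \<open>\<nu>\<close> are partitions of the same integer.\<close>

definition lower_partition :: "nat multiset \<Rightarrow> nat multiset \<Rightarrow> bool" where
  "lower_partition \<mu> \<nu> \<longleftrightarrow>
     \<mu> \<noteq> \<nu> \<and>
     (\<exists>G :: nat multiset multiset. sum_mset G = \<mu> \<and> image_mset sum_mset G = \<nu>)"

subsection \<open>Congruence modulo low degree elements and lower staircase forms\<close>

definition lower_ideal :: "(nat \<times> nat) list \<Rightarrow> xypoly mat \<Rightarrow> xypoly set" where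
  "lower_ideal D S =
     genideal (xy_ring (length D))
       (low_degree_ideal (length D) (total_deg D) \<union>
        {det S' | D' S'. length D' = length D \<and> staircase_form D' S' \<and> det S' \<noteq> 0 \<and>
           lower_partition (partition_type D' S') (partition_type D S)})"

text \<open>\<open>S\<close> is a staircase form of \<open>D\<close>; it only serves to name the partition type of \<open>D\<close>.\<close>

definition equiv_mod_lower ::
  "(nat \<times> nat) list \<Rightarrow> xypoly mat \<Rightarrow> xypoly \<Rightarrow> xypoly \<Rightarrow> bool" where
  "equiv_mod_lower D S f g \<longleftrightarrow> f - g \<in> lower_ideal D S"

end

theory Submission
  imports Defs
begin

text \<open>Indices start at 0. Let \<open>s\<^sub>j\<close> be the degree of the point \<open>P\<^sub>j\<close>, let \<open>r\<close> be the first index of the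
  last block, \<open>w = j\<^sub>r\<close> the number of nonzero entries above its diagonal, and \<open>m = n - t\<close>. If some
  \<open>s\<^sub>j\<close> exceeds \<open>j\<close>, too many columns of a staircase form vanish in its first rows and all alternants
  of the theorem lie in \<open>I\<^bsub><d\<^esub>\<close>. So let \<open>s\<^sub>j \<le> j\<close> for all \<open>j\<close>.

  If \<open>w = 0\<close>, both parts are vacuous: \<open>P\<^sub>1 = (1,0)\<close> has no y-factor, and a last
  block of size 1 is minimal and starts at \<open>m\<close>.
  So let \<open>w \<ge> 1\<close>.

  Everything comes from one relation. Write \<open>P\<^sub>m = (0,1) + q\<close> and let \<open>E\<close> be the sequence \<open>D\<close> with
  \<open>P\<^sub>m\<close> replaced by \<open>(0,1)\<close>. The alternant of \<open>E\<close> lies in \<open>I\<close> and has degree less than \<open>d\<close>, so its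
  product with the power sum of the monomials \<open>x\<^sub>i^(fst q) * y\<^sub>i^(snd q)\<close> lies in \<open>I\<^bsub><d\<^esub>\<close>. This product is the
  sum over \<open>k\<close> of the alternants of \<open>E\<close> with \<open>q\<close> added to the \<open>k\<close>-th point (\<open>sum_raised_low\<close>).
  The term \<open>k = m\<close> is the alternant of \<open>D\<close>, and the term \<open>k = 1\<close> is minus that of \<open>D_se\<close>, because
  \<open>(1,0)\<close> and \<open>(0,1)\<close> have changed places (\<open>trade_sum_low\<close>). The others are controlled by their
  degrees (\<open>trade_with_last_block\<close>):
  \<^item> \<open>k = 0\<close>: no point of degree 0 is left, and the term vanishes modulo \<open>I\<^bsub><d\<^esub>\<close>.
  \<^item> \<open>2 \<le> k \<le> w\<close>: the first points now have degrees \<open>0, 1, 1, 2, \<dots>, k - 1\<close>, which is a block with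
    \<open>k - 1\<close> entries above the diagonal; the last block keeps \<open>w - k + 1 > 0\<close> of its \<open>w\<close> entries. The
    part \<open>w\<close> has been split, so the partition type is lower (\<open>transfer_term_in_lower\<close>).
  \<^item> \<open>k \<ge> w + 2\<close>: the last block has size at most \<open>w + 1\<close>, so the raised point has degree at least
    \<open>n\<close> and the term vanishes.
  \<^item> \<open>k = w + 1\<close>: all \<open>w\<close> entries move, the partition type stays the same, and the term survives in
    general. Call it \<open>T\<close>.

  Part (b) is the case where \<open>T\<close> vanishes too: its raised point has degree \<open>s\<^sub>m + w\<close>, and this is less
  than \<open>n\<close> only if the last block is minimal and \<open>s\<^sub>m = r\<close>.

  For part (a), apply the relation to \<open>D\<close> and to \<open>D_nw\<close>. The raised point of \<open>T\<close> is \<open>P\<^bsub>w+1\<^esub> + q\<close>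
  in both cases, since the shifts \<open>(1,-1)\<close> and \<open>(-1,1)\<close> compensate each other; so \<open>T\<close> cancels. What
  remains is the sequence obtained from \<open>D_nw\<close> by the trade, which differs from \<open>D\<close> only by a trade
  between the points 1 and \<open>w + 1\<close>. Both form blocks of size 1, and the relation for the first
  \<open>w + 2\<close> points alone shows that this changes the alternant only by an element of \<open>I\<^bsub><d\<^esub>\<close>
  (\<open>trade_in_chain_low\<close>).\<close>

section \<open>Membership in the polynomial ring and in its ideals\<close>

lemma xy_ring_simps [simp]:
  "monoid.mult (xy_ring n) = (*)" "one (xy_ring n) = 1"
  "zero (xy_ring n) = 0" "add (xy_ring n) = (+)"
  by (simp_all add: xy_ring_def)

lemma xy_carrier_iff:
  "p \<in> carrier (xy_ring n) \<longleftrightarrow>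
    (\<forall>m\<in>Poly_Mapping.keys p. Poly_Mapping.keys m \<subseteq> XV ` {..<n} \<union> YV ` {..<n})"
  by (simp add: xy_ring_def)

lemma xy_carrier_0: "0 \<in> carrier (xy_ring n)"
  by (simp add: xy_carrier_iff)

lemma xy_carrier_1: "1 \<in> carrier (xy_ring n)"
  by (simp add: xy_carrier_iff)

lemma xy_carrier_add:
  "p \<in> carrier (xy_ring n) \<Longrightarrow> q \<in> carrier (xy_ring n) \<Longrightarrow> p + q \<in> carrier (xy_ring n)"
  unfolding xy_carrier_iff using Poly_Mapping.keys_add[of p q] by blast

lemma xy_carrier_uminus: "p \<in> carrier (xy_ring n) \<Longrightarrow> - p \<in> carrier (xy_ring n)"
  by (simp add: xy_carrier_iff)

lemma xy_carrier_diff: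
  "p \<in> carrier (xy_ring n) \<Longrightarrow> q \<in> carrier (xy_ring n) \<Longrightarrow> p - q \<in> carrier (xy_ring n)"
  using xy_carrier_add[of p n "- q"] xy_carrier_uminus[of q n] by simp

lemma xy_carrier_mult:
  assumes "p \<in> carrier (xy_ring n)" "q \<in> carrier (xy_ring n)"
  shows "p * q \<in> carrier (xy_ring n)"
  unfolding xy_carrier_iff
proof
  fix m assume "m \<in> Poly_Mapping.keys (p * q)"
  then obtain a b where "m = a + b" "a \<in> Poly_Mapping.keys p" "b \<in> Poly_Mapping.keys q"
    using keys_mult[of p q] by blast
  then show "Poly_Mapping.keys m \<subseteq> XV ` {..<n} \<union> YV ` {..<n}"
    using assms Poly_Mapping.keys_add[of a b] unfolding xy_carrier_iff by blast
qed

lemma xy_carrier_power: "p \<in> carrier (xy_ring n) \<Longrightarrow> p ^ k \<in> carrier (xy_ring n)"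
  by (induction k) (auto intro: xy_carrier_1 xy_carrier_mult)

lemma xy_carrier_prod:
  "(\<And>i. i \<in> A \<Longrightarrow> f i \<in> carrier (xy_ring n)) \<Longrightarrow> prod f A \<in> carrier (xy_ring n)"
  by (induction A rule: infinite_finite_induct) (auto intro: xy_carrier_1 xy_carrier_mult)

lemma xy_carrier_sum:
  "(\<And>i. i \<in> A \<Longrightarrow> f i \<in> carrier (xy_ring n)) \<Longrightarrow> sum f A \<in> carrier (xy_ring n)"
  by (induction A rule: infinite_finite_induct) (auto intro: xy_carrier_0 xy_carrier_add)

lemma xy_carrier_xvar: "i < n \<Longrightarrow> xvar i \<in> carrier (xy_ring n)"
  by (auto simp: xy_carrier_iff xvar_def)

lemma xy_carrier_yvar: "i < n \<Longrightarrow> yvar i \<in> carrier (xy_ring n)"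
  by (auto simp: xy_carrier_iff yvar_def)

lemma signof_cases: "signof p = (1 :: 'a :: comm_ring_1) \<or> signof p = (- 1 :: 'a)"
  by (simp add: sign_def)

lemma xy_carrier_signof: "signof p \<in> carrier (xy_ring n)"
  using signof_cases[of p, where 'a = xypoly] xy_carrier_1 xy_carrier_uminus[OF xy_carrier_1]
  by metis

lemmas xy_carrier_intros =
  xy_carrier_0 xy_carrier_1 xy_carrier_add xy_carrier_uminus xy_carrier_diff xy_carrier_mult
  xy_carrier_power xy_carrier_prod xy_carrier_sum xy_carrier_xvar xy_carrier_yvar
  xy_carrier_signof

lemma xy_ring_cring: "cring (xy_ring n)"
proof (intro cringI abelian_groupI comm_monoidI)
  fix x assume "x \<in> carrier (xy_ring n)"
  then show "\<exists>y\<in>carrier (xy_ring n). y \<oplus>\<^bsub>xy_ring n\<^esub> x = \<zero>\<^bsub>xy_ring n\<^esub>"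
    by (intro bexI[of _ "- x"]) (auto intro: xy_carrier_intros)
qed (auto intro: xy_carrier_intros simp: algebra_simps)

lemma xy_ring_ring: "ring (xy_ring n)"
  using xy_ring_cring by (simp add: cring_def)

lemma xy_genideal_ideal: "G \<subseteq> carrier (xy_ring n) \<Longrightarrow> ideal (genideal (xy_ring n) G) (xy_ring n)"
  by (rule ring.genideal_ideal[OF xy_ring_ring])

lemma xy_genideal_incl: "G \<subseteq> carrier (xy_ring n) \<Longrightarrow> f \<in> G \<Longrightarrow> f \<in> genideal (xy_ring n) G"
  using ring.genideal_self[OF xy_ring_ring] by blast

context
  fixes n :: nat and L :: "xypoly set"
  assumes L: "ideal L (xy_ring n)"
begin

lemma xy_ideal_carrier: "f \<in> L \<Longrightarrow> f \<in> carrier (xy_ring n)"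
  using ideal.Icarr[OF L] .

lemma xy_ideal_0: "0 \<in> L"
  using additive_subgroup.zero_closed[OF ideal.axioms(1)[OF L]] by simp

lemma xy_ideal_add: "f \<in> L \<Longrightarrow> g \<in> L \<Longrightarrow> f + g \<in> L"
  using additive_subgroup.a_closed[OF ideal.axioms(1)[OF L], of f g] by simp

lemma xy_ideal_mult: "f \<in> L \<Longrightarrow> c \<in> carrier (xy_ring n) \<Longrightarrow> c * f \<in> L"
  using ideal.I_l_closed[OF L, of f c] by simp

lemma xy_ideal_uminus: "f \<in> L \<Longrightarrow> - f \<in> L"
  using xy_ideal_mult[of f "- 1"] by (simp add: xy_carrier_1 xy_carrier_uminus)

lemma xy_ideal_diff: "f \<in> L \<Longrightarrow> g \<in> L \<Longrightarrow> f - g \<in> L"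
  using xy_ideal_add[of f "- g"] xy_ideal_uminus[of g] by simp

lemma xy_ideal_sum: "(\<And>i. i \<in> A \<Longrightarrow> f i \<in> L) \<Longrightarrow> sum f A \<in> L"
  by (induction A rule: infinite_finite_induct) (auto intro: xy_ideal_0 xy_ideal_add)

lemma xy_ideal_signof_mult: "signof p * f \<in> L \<longleftrightarrow> f \<in> L"
  using signof_cases[of p, where 'a = xypoly] xy_ideal_uminus[of f] xy_ideal_uminus[of "- f"]
  by auto

lemma xy_ideal_prod:
  assumes "finite A" "k \<in> A" "f k \<in> L" "\<And>i. i \<in> A \<Longrightarrow> f i \<in> carrier (xy_ring n)"
  shows "prod f A \<in> L"
proof -
  have "prod f A = prod f (A - {k}) * f k"
    using assms(1,2) by (metis mult.commute prod.remove)
  then show ?thesis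
    using assms by (auto intro!: xy_ideal_mult xy_carrier_prod)
qed

end

section \<open>Homogeneous polynomials\<close>

definition mdeg :: "(xyvar \<Rightarrow>\<^sub>0 nat) \<Rightarrow> nat" where
  "mdeg m = (\<Sum>v\<in>Poly_Mapping.keys m. Poly_Mapping.lookup m v)"

lemma mdeg_superset:
  assumes "finite A" "Poly_Mapping.keys m \<subseteq> A"
  shows "mdeg m = (\<Sum>v\<in>A. Poly_Mapping.lookup m v)"
  unfolding mdeg_def by (rule sum.mono_neutral_left) (use assms in \<open>auto simp: in_keys_iff\<close>)

lemma mdeg_add: "mdeg (a + b) = mdeg a + mdeg b"
proof -
  let ?A = "Poly_Mapping.keys a \<union> Poly_Mapping.keys b"
  have "mdeg (a + b) = (\<Sum>v\<in>?A. Poly_Mapping.lookup (a + b) v)"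
    by (rule mdeg_superset) (use Poly_Mapping.keys_add[of a b] in auto)
  also have "\<dots> = mdeg a + mdeg b"
    by (simp add: mdeg_superset[of ?A a] mdeg_superset[of ?A b] lookup_add sum.distrib)
  finally show ?thesis .
qed

lemma homogeneous_iff: "homogeneous k p \<longleftrightarrow> (\<forall>m\<in>Poly_Mapping.keys p. mdeg m = k)"
  by (simp add: homogeneous_def mdeg_def)

lemma homogeneous_mult: "homogeneous k p \<Longrightarrow> homogeneous l q \<Longrightarrow> homogeneous (k + l) (p * q)"
  unfolding homogeneous_iff using keys_mult[of p q] by (auto simp: mdeg_add)

lemma homogeneous_add: "homogeneous k p \<Longrightarrow> homogeneous k q \<Longrightarrow> homogeneous k (p + q)"
  unfolding homogeneous_iff using Poly_Mapping.keys_add[of p q] by auto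

lemma homogeneous_0: "homogeneous k 0"
  by (simp add: homogeneous_iff)

lemma homogeneous_1: "homogeneous 0 1"
  by (simp add: homogeneous_iff mdeg_def)

lemma homogeneous_sum: "(\<And>i. i \<in> A \<Longrightarrow> homogeneous k (f i)) \<Longrightarrow> homogeneous k (sum f A)"
  by (induction A rule: infinite_finite_induct) (auto intro: homogeneous_0 homogeneous_add)

lemma homogeneous_prod:
  "(\<And>i. i \<in> A \<Longrightarrow> homogeneous (k i) (f i)) \<Longrightarrow> homogeneous (sum k A) (prod f A)"
  by (induction A rule: infinite_finite_induct) (auto intro: homogeneous_1 homogeneous_mult)

lemma homogeneous_power: "homogeneous k p \<Longrightarrow> homogeneous (k * m) (p ^ m)"
  by (induction m) (auto intro: homogeneous_1 homogeneous_mult)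

lemma homogeneous_signof_mult: "homogeneous k p \<Longrightarrow> homogeneous k (signof q * p)"
  using signof_cases[of q, where 'a = xypoly] by (auto simp: homogeneous_iff)

lemma homogeneous_xvar: "homogeneous 1 (xvar i)"
  by (simp add: homogeneous_iff xvar_def mdeg_def)

lemma homogeneous_yvar: "homogeneous 1 (yvar i)"
  by (simp add: homogeneous_iff yvar_def mdeg_def)

definition xymono :: "nat \<times> nat \<Rightarrow> nat \<Rightarrow> xypoly" where
  "xymono p i = xvar i ^ fst p * yvar i ^ snd p"

lemma xymono_carrier: "i < n \<Longrightarrow> xymono p i \<in> carrier (xy_ring n)"
  by (auto simp: xymono_def intro: xy_carrier_intros)

lemma xymono_homogeneous: "homogeneous (pt_deg p) (xymono p i)"
  unfolding xymono_def pt_deg_def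
  using homogeneous_mult[OF homogeneous_power[OF homogeneous_xvar] homogeneous_power[OF homogeneous_yvar]]
  by simp

section \<open>Determinants as functions of their columns\<close>

text \<open>Columns are functions of the row index, so that replacing the \<open>k\<close>-th column is the function
  update \<open>C(k := f)\<close>, and \<open>C j i\<close> makes sense for every \<open>i\<close>.\<close>
definition altdet :: "nat \<Rightarrow> (nat \<Rightarrow> nat \<Rightarrow> xypoly) \<Rightarrow> xypoly" where
  "altdet n C = det (mat n n (\<lambda>(i, j). C j i))"

lemma altdet_leibniz:
  "altdet n C = (\<Sum>p | p permutes {0..<n}. signof p * (\<Prod>j<n. C j (p j)))"
  unfolding altdet_def
  by (subst det_col[of _ n]) (auto intro!: sum.cong prod.cong simp: permutes_def)

lemma Delta_altdet: "Delta D = altdet (length D) (\<lambda>j. xymono (D ! j))"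
  by (simp add: Delta_def altdet_def xymono_def)

lemma permutes_lt: "p permutes {0..<n :: nat} \<Longrightarrow> j < n \<Longrightarrow> p j < n"
  using permutes_in_image[of p "{0..<n}" j] by simp

lemma altdet_carrier:
  "(\<And>i j. i < n \<Longrightarrow> j < n \<Longrightarrow> C j i \<in> carrier (xy_ring n)) \<Longrightarrow> altdet n C \<in> carrier (xy_ring n)"
  unfolding altdet_leibniz by (auto intro!: xy_carrier_intros dest: permutes_lt)

lemma altdet_cong:
  "(\<And>i j. i < n \<Longrightarrow> j < n \<Longrightarrow> C j i = C' j i) \<Longrightarrow> altdet n C = altdet n C'"
  unfolding altdet_leibniz by (auto intro!: sum.cong prod.cong arg_cong2[of _ _ _ _ "(*)"] dest: permutes_lt)

lemma altdet_add_column: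
  assumes "k < n"
  shows "altdet n (C(k := (\<lambda>i. f i + c * g i))) = altdet n (C(k := f)) + c * altdet n (C(k := g))"
proof -
  have *: "(\<Prod>j<n. (C(k := h)) j (p j)) = h (p k) * (\<Prod>j\<in>{..<n} - {k}. C j (p j))" for h p
  proof -
    have "(\<Prod>j<n. (C(k := h)) j (p j)) = (C(k := h)) k (p k) * (\<Prod>j\<in>{..<n} - {k}. (C(k := h)) j (p j))"
      by (rule prod.remove) (use assms in auto)
    then show ?thesis by simp
  qed
  show ?thesis
    unfolding altdet_leibniz * sum_distrib_left sum.distrib[symmetric]
    by (auto intro!: sum.cong simp: algebra_simps)
qed

lemma altdet_zero_column:
  assumes "k < n"
  shows "altdet n (C(k := (\<lambda>i. 0))) = 0"
  using altdet_add_column[OF assms, of C "\<lambda>i. 0" "- 1" "\<lambda>i. 0"] by simp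

lemma altdet_permute:
  assumes p: "p permutes {0..<n}"
  shows "altdet n (\<lambda>j. C (p j)) = signof p * altdet n C"
proof -
  let ?A = "mat n n (\<lambda>(i, j). C i j)"
  have t: "altdet n C = det (mat n n (\<lambda>(i, j). C i j))" for C
    unfolding altdet_def
    by (subst det_transpose[of _ n, symmetric]) (auto intro!: arg_cong[of _ _ det])
  have "altdet n (\<lambda>j. C (p j)) = det (mat n n (\<lambda>(i, j). ?A $$ (p i, j)))"
    unfolding t by (intro arg_cong[of _ _ det] eq_matI) (auto dest: permutes_lt[OF p])
  also have "\<dots> = signof p * det ?A"
    by (rule det_permute_rows) (use p in auto)
  finally show ?thesis by (simp add: t)
qed

text \<open>A permutation cannot send the more than \<open>n - m\<close> columns in \<open>J\<close> into the \<open>n - m\<close> rows below the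
  zero block, so every term of the Leibniz expansion has a zero factor.\<close>
lemma altdet_zero_block:
  assumes J: "J \<subseteq> {..<n}" and card: "n < m + card J" and m: "m \<le> n"
    and zero: "\<And>i j. i < m \<Longrightarrow> j \<in> J \<Longrightarrow> C j i = 0"
  shows "altdet n C = 0"
  unfolding altdet_leibniz
proof (rule sum.neutral, safe)
  fix p assume p: "p permutes {0..<n}"
  have "\<exists>j\<in>J. p j < m"
  proof (rule ccontr)
    assume "\<not> (\<exists>j\<in>J. p j < m)"
    then have "p ` J \<subseteq> {m..<n}"
      using J permutes_lt[OF p] by (force simp: not_less)
    then have "card (p ` J) \<le> n - m"
      using card_mono[of "{m..<n}" "p ` J"] by simp
    moreover have "card (p ` J) = card J"
      by (rule card_image) (use permutes_inj[OF p] in \<open>auto intro: inj_on_subset\<close>)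
    ultimately show False using card m by simp
  qed
  then obtain j where "j \<in> J" "p j < m" by blast
  then have "(\<Prod>j<n. C j (p j)) = 0"
    using J zero by (intro prod_zero) auto
  then show "signof p * (\<Prod>j<n. C j (p j)) = 0" by simp
qed

text \<open>In the Leibniz expansion only permutations that preserve \<open>{..<m}\<close> contribute, because the remaining
  columns vanish in the first \<open>m\<close> rows. Multiplying the column \<open>k < m\<close> by \<open>w\<close> multiplies the term of
  \<open>p\<close> by \<open>w (p k)\<close>, and summing over \<open>k\<close> yields the same factor for each of these permutations.\<close>
lemma altdet_partial_raise:
  assumes zero: "\<And>i j. i < m \<Longrightarrow> m \<le> j \<Longrightarrow> j < n \<Longrightarrow> C j i = 0" and m: "m \<le> n"
  shows "(\<Sum>k<m. altdet n (C(k := (\<lambda>i. w i * C k i)))) = (\<Sum>i<m. w i) * altdet n C"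
proof -
  have 1: "(\<Prod>j<n. (C(k := (\<lambda>i. w i * C k i))) j (p j)) = w (p k) * (\<Prod>j<n. C j (p j))"
    if "k < m" for k p
  proof -
    have "(\<Prod>j<n. (C(k := (\<lambda>i. w i * C k i))) j (p j))
        = (C(k := (\<lambda>i. w i * C k i))) k (p k) * (\<Prod>j\<in>{..<n} - {k}. (C(k := (\<lambda>i. w i * C k i))) j (p j))"
      by (rule prod.remove) (use that m in auto)
    also have "\<dots> = w (p k) * (C k (p k) * (\<Prod>j\<in>{..<n} - {k}. C j (p j)))"
      by (simp add: mult.assoc)
    also have "C k (p k) * (\<Prod>j\<in>{..<n} - {k}. C j (p j)) = (\<Prod>j<n. C j (p j))"
      by (rule prod.remove[symmetric]) (use that m in auto)
    finally show ?thesis .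
  qed
  have 2: "(\<Sum>k<m. w (p k)) * (\<Prod>j<n. C j (p j)) = (\<Sum>i<m. w i) * (\<Prod>j<n. C j (p j))"
    if p: "p permutes {0..<n}" for p
  proof (cases "\<forall>j\<in>{m..<n}. m \<le> p j")
    case True
    have "p ` {m..<n} = {m..<n}"
    proof (rule card_subset_eq)
      show "p ` {m..<n} \<subseteq> {m..<n}"
        using True permutes_lt[OF p] by auto
      show "card (p ` {m..<n}) = card {m..<n}"
        by (rule card_image) (use permutes_inj[OF p] in \<open>auto intro: inj_on_subset\<close>)
    qed simp
    moreover have "p ` {0..<n} = {0..<n}"
      by (rule permutes_image[OF p])
    moreover have "{..<m} = {0..<n} - {m..<n}" using m by auto
    ultimately have "p ` {..<m} = {..<m}"
      using image_set_diff[OF permutes_inj[OF p]] by metis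
    then have "bij_betw p {..<m} {..<m}"
      using permutes_inj[OF p] by (auto simp: bij_betw_def intro: inj_on_subset)
    then have "(\<Sum>k<m. w (p k)) = (\<Sum>i<m. w i)"
      by (rule sum.reindex_bij_betw)
    then show ?thesis by simp
  next
    case False
    then obtain j where "j \<in> {m..<n}" "p j < m" by force
    then have "(\<Prod>j<n. C j (p j)) = 0"
      using zero by (intro prod_zero) auto
    then show ?thesis by simp
  qed
  have "(\<Sum>k<m. altdet n (C(k := (\<lambda>i. w i * C k i))))
      = (\<Sum>p | p permutes {0..<n}. \<Sum>k<m. signof p * (w (p k) * (\<Prod>j<n. C j (p j))))"
    unfolding altdet_leibniz by (subst sum.swap) (simp add: 1 del: fun_upd_apply)
  also have "\<dots> = (\<Sum>p | p permutes {0..<n}. signof p * ((\<Sum>k<m. w (p k)) * (\<Prod>j<n. C j (p j))))"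
    by (simp add: sum_distrib_left sum_distrib_right)
  also have "\<dots> = (\<Sum>i<m. w i) * altdet n C"
    unfolding altdet_leibniz sum_distrib_left
    by (rule sum.cong) (simp_all add: 2 algebra_simps)
  finally show ?thesis .
qed

section \<open>Alternants and the ideal of low degree\<close>

definition padd :: "nat \<times> nat \<Rightarrow> nat \<times> nat \<Rightarrow> nat \<times> nat" where
  "padd p q = (fst p + fst q, snd p + snd q)"

lemma xymono_padd: "xymono (padd p q) i = xymono q i * xymono p i"
  by (simp add: padd_def xymono_def power_add algebra_simps)

lemma pt_deg_Pair [simp]: "pt_deg (a, b) = a + b"
  by (simp add: pt_deg_def)

lemma pt_deg_padd [simp]: "pt_deg (padd p q) = pt_deg p + pt_deg q"
  by (simp add: padd_def pt_deg_def)

lemma total_deg_sum: "total_deg D = (\<Sum>j<length D. pt_deg (D ! j))"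
  by (simp add: total_deg_def sum_list_sum_nth atLeast0LessThan)

lemma Delta_carrier: "length D = n \<Longrightarrow> Delta D \<in> carrier (xy_ring n)"
  by (auto simp: Delta_altdet intro!: altdet_carrier xymono_carrier)

lemma Delta_homogeneous: "homogeneous (total_deg D) (Delta D)"
  unfolding Delta_altdet altdet_leibniz total_deg_sum
  by (intro homogeneous_sum homogeneous_signof_mult homogeneous_prod xymono_homogeneous)

lemma altdet_subtract_row:
  assumes "i < n" "j < n" "i \<noteq> j"
  shows "altdet n C = altdet n (\<lambda>k l. if l = i then C k i - C k j else C k l)"
proof -
  let ?A = "mat n n (\<lambda>(i, j). C j i)"
  have "altdet n C = det (addrow (- 1) i j ?A)"
    unfolding altdet_def using assms by (subst det_addrow[of _ n]) auto
  also have "addrow (- 1) i j ?A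
      = mat n n (\<lambda>(l, k). if l = i then C k i - C k j else C k l)"
    using assms by (intro eq_matI) (auto simp: mat_addrow_def)
  finally show ?thesis unfolding altdet_def .
qed

text \<open>Modulo \<open>x\<^sub>i - x\<^sub>j\<close> and \<open>y\<^sub>i - y\<^sub>j\<close> the rows \<open>i\<close> and \<open>j\<close> agree, so after subtracting one from
  the other every term of the Leibniz expansion has a factor in the ideal.\<close>
lemma Delta_diagonal_ideal:
  assumes n: "length D = n"
  shows "Delta D \<in> diagonal_ideal n"
  unfolding diagonal_ideal_def
proof (safe intro!: Delta_carrier n)
  fix i j assume ij: "i < j" "j < n"
  let ?G = "{xvar i - xvar j, yvar i - yvar j}"
  let ?J = "genideal (xy_ring n) ?G"
  have G: "?G \<subseteq> carrier (xy_ring n)"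
    using ij by (auto intro!: xy_carrier_intros)
  note J = xy_genideal_ideal[OF G]
  have power: "f ^ k - g ^ k \<in> ?J"
    if "f - g \<in> ?J" "f \<in> carrier (xy_ring n)" "g \<in> carrier (xy_ring n)" for f g k
    using that unfolding power_diff_sumr2 mult.commute[of "f - g"]
    by (auto intro!: xy_ideal_mult[OF J] xy_carrier_intros)
  have mono: "xymono p i - xymono p j \<in> ?J" for p
  proof -
    have "xymono p i - xymono p j
        = yvar i ^ snd p * (xvar i ^ fst p - xvar j ^ fst p)
        + xvar j ^ fst p * (yvar i ^ snd p - yvar j ^ snd p)"
      by (simp add: xymono_def algebra_simps)
    also have "\<dots> \<in> ?J"
      using ij G
      by (intro xy_ideal_add[OF J] xy_ideal_mult[OF J] power xy_carrier_intros
          xy_genideal_incl[OF G]) auto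
    finally show ?thesis .
  qed
  define C where "C = (\<lambda>k l. if l = i then xymono (D ! k) i - xymono (D ! k) j else xymono (D ! k) l)"
  have "Delta D = altdet n C"
    unfolding Delta_altdet n C_def using ij by (intro altdet_subtract_row) auto
  also have "\<dots> \<in> ?J"
    unfolding altdet_leibniz
  proof (intro xy_ideal_sum[OF J], safe)
    fix p assume p: "p permutes {0..<n}"
    obtain k where k: "k < n" "p k = i"
      using permutes_image[OF p] ij by (metis (no_types, lifting) atLeastLessThan_iff imageE le0 less_trans)
    have "(\<Prod>j<n. C j (p j)) \<in> ?J"
      by (rule xy_ideal_prod[OF J, of _ k])
        (use k ij mono permutes_lt[OF p] in \<open>auto simp: C_def intro!: xy_carrier_intros xymono_carrier\<close>)
    then show "signof p * (\<Prod>j<n. C j (p j)) \<in> ?J"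
      by (simp only: xy_ideal_signof_mult[OF J])
  qed
  finally show "Delta D \<in> ?J" .
qed

lemma low_generators_carrier:
  "{f \<in> diagonal_ideal n. \<exists>k<d. homogeneous k f} \<subseteq> carrier (xy_ring n)"
  by (auto simp: diagonal_ideal_def)

lemma low_degree_ideal: "ideal (low_degree_ideal n d) (xy_ring n)"
  unfolding low_degree_ideal_def by (rule xy_genideal_ideal[OF low_generators_carrier])

lemma low_degree_ideal_mono:
  assumes "d \<le> d'" shows "low_degree_ideal n d \<subseteq> low_degree_ideal n d'"
proof -
  have "{f \<in> diagonal_ideal n. \<exists>k<d. homogeneous k f} \<subseteq> low_degree_ideal n d'"
    unfolding low_degree_ideal_def using assms
    by (intro subsetI xy_genideal_incl low_generators_carrier) (auto intro: less_le_trans)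
  then show ?thesis
    unfolding low_degree_ideal_def[of n d]
    by (rule ring.genideal_minimal[OF xy_ring_ring low_degree_ideal])
qed

lemma Delta_low:
  assumes "length D = n" "total_deg D < d"
  shows "Delta D \<in> low_degree_ideal n d"
  unfolding low_degree_ideal_def
  by (rule xy_genideal_incl[OF low_generators_carrier])
    (use assms Delta_diagonal_ideal Delta_homogeneous in auto)

section \<open>Replacing monomial columns by monic columns\<close>

text \<open>Columns that are combinations of monomial columns of degree less than \<open>m\<close>, where the coefficients
  are arbitrary polynomials that do not depend on the row.\<close>
inductive colspan :: "nat \<Rightarrow> nat \<Rightarrow> (nat \<Rightarrow> xypoly) \<Rightarrow> bool" for n m where
  zero: "colspan n m (\<lambda>i. 0)"
| add: "colspan n m f \<Longrightarrow> pt_deg p < m \<Longrightarrow> c \<in> carrier (xy_ring n) \<Longrightarrow>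
    colspan n m (\<lambda>i. f i + c * xymono p i)"

lemma colspan_plus:
  assumes "colspan n m g" "colspan n m f"
  shows "colspan n m (\<lambda>i. f i + g i)"
  using assms(1)
proof induction
  case zero
  then show ?case using assms(2) by simp
next
  case (add g p c)
  from colspan.add[OF add.IH add.hyps(2,3)] show ?case by (simp add: add.assoc)
qed

lemma colspan_mono: "colspan n m f \<Longrightarrow> m \<le> m' \<Longrightarrow> colspan n m' f"
  by (induction rule: colspan.induct) (auto intro: colspan.intros)

lemma colspan_smult:
  assumes "colspan n m f" "c \<in> carrier (xy_ring n)"
  shows "colspan n m (\<lambda>i. c * f i)"
  using assms(1)
proof induction
  case zero
  then show ?case by (simp add: colspan.zero)
next
  case (add f p c')
  from colspan.add[OF add.IH add.hyps(2) xy_carrier_mult[OF assms(2) add.hyps(3)]]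
  show ?case by (simp add: algebra_simps)
qed

lemma colspan_xymono: "pt_deg p < m \<Longrightarrow> colspan n m (xymono p)"
  using colspan.add[OF colspan.zero _ xy_carrier_1, of p m n] by simp

lemma colspan_raise:
  assumes "colspan n m f"
  shows "colspan n (m + pt_deg q) (\<lambda>i. xymono q i * f i)"
  using assms
proof induction
  case zero
  then show ?case by (simp add: colspan.zero)
next
  case (add f p c)
  have "pt_deg (padd p q) < m + pt_deg q" using add.hyps by simp
  from colspan.add[OF add.IH this add.hyps(3)]
  show ?case by (simp add: algebra_simps xymono_padd)
qed

lemma colspan_0: "colspan n 0 f \<Longrightarrow> f = (\<lambda>i. 0)"
  by (induction rule: colspan.induct) auto

text \<open>The column function agrees with the monomial \<open>p\<close> up to monomials of lower degree.\<close>
definition monic_col :: "nat \<Rightarrow> nat \<times> nat \<Rightarrow> (nat \<Rightarrow> xypoly) \<Rightarrow> bool" where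
  "monic_col n p f \<longleftrightarrow> colspan n (pt_deg p) (\<lambda>i. f i - xymono p i)"

lemma monic_col_xymono: "monic_col n p (xymono p)"
  by (simp add: monic_col_def colspan.zero)

lemma monic_col_colspan:
  assumes "monic_col n p f" shows "colspan n (Suc (pt_deg p)) f"
  using colspan_plus[OF colspan_xymono[of p "Suc (pt_deg p)" n] colspan_mono[of n "pt_deg p"]] assms
  by (fastforce simp: monic_col_def)

lemma monic_col_raise:
  assumes "monic_col n p f" shows "monic_col n (padd p q) (\<lambda>i. xymono q i * f i)"
  using colspan_raise[of n "pt_deg p" "\<lambda>i. f i - xymono p i" q] assms
  by (simp add: monic_col_def xymono_padd algebra_simps)

lemma monic_col_shifted_raise:
  assumes f: "monic_col n p f" and q: "pt_deg q = 1" and u: "u \<in> carrier (xy_ring n)"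
  shows "monic_col n (padd p q) (\<lambda>i. (xymono q i - u) * f i)"
proof -
  have "colspan n (Suc (pt_deg p)) (\<lambda>i. (- u) * f i)"
    by (intro colspan_smult monic_col_colspan f xy_carrier_uminus u)
  from colspan_plus[OF this] monic_col_raise[OF f, of q] q show ?thesis
    by (force simp: monic_col_def algebra_simps)
qed

text \<open>With \<open>u = xvar\<close> and \<open>v = yvar\<close> this is the column of a staircase form whose first
  \<open>fst p\<close> factors are the differences of x-variables.\<close>
definition staircol :: "(nat \<Rightarrow> xypoly) \<Rightarrow> (nat \<Rightarrow> xypoly) \<Rightarrow> nat \<times> nat \<Rightarrow> nat \<Rightarrow> xypoly" where
  "staircol u v p i = (\<Prod>l<pt_deg p. if l < fst p then xvar i - u l else yvar i - v l)"

lemma xymono_linear: "xymono (Suc 0, 0) = xvar" "xymono (0, Suc 0) = yvar"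
  by (simp_all add: xymono_def fun_eq_iff)

lemma monic_col_staircol:
  assumes "\<And>l. u l \<in> carrier (xy_ring n)" "\<And>l. v l \<in> carrier (xy_ring n)"
  shows "monic_col n p (staircol u v p)"
proof -
  let ?f = "\<lambda>l i. if l < fst p then xvar i - u l else yvar i - v l"
  have "monic_col n (min m (fst p), m - fst p) (\<lambda>i. \<Prod>l<m. ?f l i)" for m
  proof (induction m)
    case 0
    show ?case using monic_col_xymono[of n "(0, 0)"] by (simp add: xymono_def[abs_def])
  next
    case (Suc m)
    show ?case
    proof (cases "m < fst p")
      case True
      with monic_col_shifted_raise[OF Suc, of "(Suc 0, 0)" "u m"] assms show ?thesis
        by (simp add: pt_deg_def padd_def xymono_linear mult.commute)
    next
      case False
      with monic_col_shifted_raise[OF Suc, of "(0, Suc 0)" "v m"] assms show ?thesis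
        by (simp add: pt_deg_def padd_def xymono_linear mult.commute Suc_diff_le not_less)
    qed
  qed
  from this[of "pt_deg p"] show ?thesis
    by (simp add: staircol_def[abs_def] pt_deg_def)
qed

lemma staircol_zero:
  assumes "i < pt_deg p" "u i = xvar i" "v i = yvar i"
  shows "staircol u v p i = 0"
  unfolding staircol_def by (rule prod_zero) (use assms in \<open>auto intro!: bexI[of _ i]\<close>)

text \<open>By multilinearity the determinant is a combination of alternants of degree at most
  \<open>\<Sum>j<n. s j\<close>. The induction expands one column after the other: at stage \<open>k\<close> the columns from \<open>k\<close> on are
  monomial already.\<close>
lemma altdet_colspan_low:
  assumes "\<And>j. j < n \<Longrightarrow> colspan n (Suc (s j)) (C j)" "(\<Sum>j<n. s j) < d"
  shows "altdet n C \<in> low_degree_ideal n d"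
proof -
  note L = low_degree_ideal[of n d]
  have "altdet n C \<in> low_degree_ideal n d"
    if "k \<le> n" "\<And>j. j < k \<Longrightarrow> colspan n (Suc (s j)) (C j)"
      "\<And>j. k \<le> j \<Longrightarrow> j < n \<Longrightarrow> \<exists>p. pt_deg p \<le> s j \<and> C j = xymono p" for k C
    using that
  proof (induction k arbitrary: C)
    case 0
    then obtain P where P: "\<And>j. j < n \<Longrightarrow> pt_deg (P j) \<le> s j \<and> C j = xymono (P j)"
      by (metis le0)
    have "altdet n C = Delta (map P [0..<n])"
      unfolding Delta_altdet length_map length_upt by (auto intro!: altdet_cong simp: P)
    moreover have "total_deg (map P [0..<n]) < d"
    proof -
      have "total_deg (map P [0..<n]) = (\<Sum>j<n. pt_deg (P j))"
        by (simp add: total_deg_sum)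
      also have "\<dots> \<le> (\<Sum>j<n. s j)" by (intro sum_mono) (simp add: P)
      finally show ?thesis using assms(2) by simp
    qed
    ultimately show ?case using Delta_low[of "map P [0..<n]" n d] by simp
  next
    case (Suc k)
    have k: "k < n" using Suc.prems by simp
    have "altdet n (C(k := f)) \<in> low_degree_ideal n d" if "colspan n (Suc (s k)) f" for f
      using that
    proof induction
      case zero
      show ?case by (simp add: altdet_zero_column k xy_ideal_0[OF L] del: fun_upd_apply)
    next
      case (add f p c)
      have "altdet n (C(k := xymono p)) \<in> low_degree_ideal n d"
      proof (rule Suc.IH)
        fix j assume j: "k \<le> j" "j < n"
        show "\<exists>p'. pt_deg p' \<le> s j \<and> (C(k := xymono p)) j = xymono p'"
        proof (cases "j = k")
          case True then show ?thesis using add.hyps(2) by (intro exI[of _ p]) simp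
        next
          case False then show ?thesis using j Suc.prems(3)[of j] by auto
        qed
      qed (use Suc.prems in auto)
      with add show ?case
        unfolding altdet_add_column[OF k] by (intro xy_ideal_add[OF L] xy_ideal_mult[OF L])
    qed
    from this[OF Suc.prems(2)[of k]] show ?case by simp
  qed
  from this[of n C] show ?thesis using assms(1) by simp
qed

text \<open>Staircase forms exist for this reason: replacing one monomial column by a monic one changes
  the determinant by a determinant in which that column has dropped in degree.\<close>
lemma altdet_monic_cols:
  assumes n: "length D = n" and C: "\<And>j. j < n \<Longrightarrow> monic_col n (D ! j) (C j)"
  shows "altdet n C - Delta D \<in> low_degree_ideal n (total_deg D)"
proof -
  note L = low_degree_ideal[of n "total_deg D"]
  let ?C = "\<lambda>k j. if j < k then C j else xymono (D ! j)"
  have "altdet n (?C k) - Delta D \<in> low_degree_ideal n (total_deg D)" if "k \<le> n" for k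
    using that
  proof (induction k)
    case 0
    then show ?case by (simp add: Delta_altdet n xy_ideal_0[OF L])
  next
    case (Suc k)
    let ?f = "\<lambda>i. C k i - xymono (D ! k) i"
    have k: "k < n" using Suc by simp
    have f: "colspan n (pt_deg (D ! k)) ?f" using C[OF k] by (simp add: monic_col_def)
    have "altdet n (?C (Suc k)) = altdet n ((?C k)(k := (\<lambda>i. xymono (D ! k) i + 1 * ?f i)))"
      by (rule arg_cong[of _ _ "altdet n"]) (auto simp: fun_eq_iff)
    also have "\<dots> = altdet n ((?C k)(k := xymono (D ! k))) + 1 * altdet n ((?C k)(k := ?f))"
      by (rule altdet_add_column[OF k])
    also have "(?C k)(k := xymono (D ! k)) = ?C k" by auto
    finally have "altdet n (?C (Suc k)) = altdet n (?C k) + altdet n ((?C k)(k := ?f))"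
      by (simp only: mult_1)
    then have eq: "altdet n (?C (Suc k)) - Delta D
        = (altdet n (?C k) - Delta D) + altdet n ((?C k)(k := ?f))"
      by (simp only: diff_add_eq)
    have "altdet n ((?C k)(k := ?f)) \<in> low_degree_ideal n (total_deg D)"
    proof (cases "pt_deg (D ! k) = 0")
      case True
      with f have "?f = (\<lambda>i. 0)" using colspan_0 by simp
      then have "altdet n ((?C k)(k := ?f)) = 0" by (simp only: altdet_zero_column[OF k])
      then show ?thesis by (simp add: xy_ideal_0[OF L])
    next
      case False
      let ?s = "(\<lambda>j. pt_deg (D ! j))(k := pt_deg (D ! k) - 1)"
      have "(\<Sum>j<n. ?s j) < (\<Sum>j<n. pt_deg (D ! j))"
        by (rule sum_strict_mono_ex1) (use False k in auto)
      then show ?thesis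
        using False f C
        by (intro altdet_colspan_low[of n ?s]) 
          (auto simp: n total_deg_sum intro: monic_col_colspan monic_col_xymono)
    qed
    with Suc show ?case unfolding eq by (intro xy_ideal_add[OF L]) auto
  qed
  from this[of n] have "altdet n (?C n) - Delta D \<in> low_degree_ideal n (total_deg D)" by simp
  also have "altdet n (?C n) = altdet n C" by (rule altdet_cong) simp
  finally show ?thesis .
qed

text \<open>A point of degree greater than \<open>n\<close> asks for more factors than there are rows. The surplus shifts
  are set to \<open>0\<close>, which keeps the column inside the ring in \<open>n\<close> pairs of variables.\<close>
definition trunc_var :: "nat \<Rightarrow> (nat \<Rightarrow> xypoly) \<Rightarrow> nat \<Rightarrow> xypoly" where
  "trunc_var n z l = (if l < n then z l else 0)"

lemma monic_col_trunc_staircol: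
  "monic_col n p (staircol (trunc_var n xvar) (trunc_var n yvar) p)"
  by (rule monic_col_staircol) (auto simp: trunc_var_def intro: xy_carrier_intros)

lemma trunc_staircol_zero:
  "i < n \<Longrightarrow> i < pt_deg p \<Longrightarrow> staircol (trunc_var n xvar) (trunc_var n yvar) p i = 0"
  by (rule staircol_zero) (auto simp: trunc_var_def)

text \<open>The vanishing criterion used throughout: too many columns of degree at least \<open>m\<close> all vanish in
  the first \<open>m\<close> rows of a staircase form, whose determinant is therefore \<open>0\<close>.\<close>
lemma Delta_low_if_crowded:
  assumes n: "length D = n" and J: "J \<subseteq> {..<n}" "\<And>j. j \<in> J \<Longrightarrow> m \<le> pt_deg (D ! j)"
    and m: "n < m + card J" "m \<le> n"
  shows "Delta D \<in> low_degree_ideal n (total_deg D)"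
proof -
  let ?C = "\<lambda>j. staircol (trunc_var n xvar) (trunc_var n yvar) (D ! j)"
  have "altdet n ?C = 0"
    by (rule altdet_zero_block[OF J(1) m]) (use J m in \<open>fastforce intro: trunc_staircol_zero\<close>)
  moreover have "altdet n ?C - Delta D \<in> low_degree_ideal n (total_deg D)"
    by (intro altdet_monic_cols n monic_col_trunc_staircol)
  ultimately show ?thesis
    using xy_ideal_uminus[OF low_degree_ideal, of "- Delta D"] by simp
qed

section \<open>Raising the columns of an alternant\<close>

lemma total_deg_update:
  "k < length D \<Longrightarrow> total_deg (D[k := p]) + pt_deg (D ! k) = total_deg D + pt_deg p"
proof (induction D arbitrary: k)
  case (Cons a D)
  then show ?case by (cases k) (auto simp: total_deg_def)
qed simp

text \<open>The source of all relations. If the points from \<open>m\<close> on have degree at least \<open>m\<close>, their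
  columns can be put into staircase form and vanish in the first \<open>m\<close> rows. Raising the first \<open>m\<close> columns in turn
  then amounts to multiplying the determinant by a power sum in the first \<open>m\<close> points, and that
  determinant is congruent to an alternant of degree too small to survive. The case \<open>m = n\<close> is the
  classical polarization identity.\<close>
lemma sum_raised_low:
  assumes n: "length D = n" and m: "m \<le> n"
    and bottom: "\<And>j. m \<le> j \<Longrightarrow> j < n \<Longrightarrow> m \<le> pt_deg (D ! j)" and q: "0 < pt_deg q"
  shows "(\<Sum>k<m. Delta (D[k := padd (D ! k) q])) \<in> low_degree_ideal n (total_deg D + pt_deg q)"
proof -
  let ?L = "low_degree_ideal n (total_deg D + pt_deg q)"
  note L = low_degree_ideal[of n "total_deg D + pt_deg q"]
  define C where "C = (\<lambda>j. if j < m then xymono (D ! j)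
      else staircol (trunc_var n xvar) (trunc_var n yvar) (D ! j))"
  let ?R = "\<lambda>k. altdet n (C(k := (\<lambda>i. xymono q i * C k i)))"
  have C: "monic_col n (D ! j) (C j)" for j
    by (simp add: C_def monic_col_xymono monic_col_trunc_staircol)
  have "altdet n C - Delta D \<in> low_degree_ideal n (total_deg D)"
    by (intro altdet_monic_cols n C)
  then have "altdet n C - Delta D \<in> ?L"
    using low_degree_ideal_mono[of "total_deg D" "total_deg D + pt_deg q" n] by auto
  moreover have "Delta D \<in> ?L"
    by (rule Delta_low) (use n q in auto)
  ultimately have "(altdet n C - Delta D) + Delta D \<in> ?L"
    by (rule xy_ideal_add[OF L])
  then have "(\<Sum>i<m. xymono q i) * altdet n C \<in> ?L"
    using m by (auto intro!: xy_ideal_mult[OF L] xy_carrier_sum xymono_carrier)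
  moreover have "(\<Sum>k<m. ?R k) = (\<Sum>i<m. xymono q i) * altdet n C"
    by (rule altdet_partial_raise[OF _ m])
      (use bottom m in \<open>fastforce simp: C_def intro: trunc_staircol_zero\<close>)
  ultimately have 1: "(\<Sum>k<m. ?R k) \<in> ?L" by simp
  have "?R k - Delta (D[k := padd (D ! k) q]) \<in> ?L" if k: "k < m" for k
  proof -
    have "total_deg (D[k := padd (D ! k) q]) = total_deg D + pt_deg q"
      using total_deg_update[of k D "padd (D ! k) q"] k m n by simp
    moreover have "?R k - Delta (D[k := padd (D ! k) q])
        \<in> low_degree_ideal n (total_deg (D[k := padd (D ! k) q]))"
      by (rule altdet_monic_cols) (use C k m n monic_col_raise[OF C] in \<open>auto simp: nth_list_update\<close>)
    ultimately show ?thesis by simp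
  qed
  then have "(\<Sum>k<m. ?R k - Delta (D[k := padd (D ! k) q])) \<in> ?L"
    by (intro xy_ideal_sum[OF L]) auto
  from xy_ideal_diff[OF L 1 this] show ?thesis by (simp add: sum_subtractf)
qed

lemma Delta_mset_eq:
  assumes "mset D = mset D'"
  shows "\<exists>p. Delta D = signof (p :: nat \<Rightarrow> nat) * Delta D'"
proof -
  from mset_eq_permutation[OF assms] obtain p where p: "p permutes {..<length D'}" "permute_list p D' = D"
    by blast
  have len: "length D = length D'" using p by auto
  have "Delta D = altdet (length D') (\<lambda>j. xymono (D' ! p j))"
    unfolding Delta_altdet len
    by (rule altdet_cong) (use p in \<open>auto simp: permute_list_nth\<close>)
  also have "\<dots> = signof p * Delta D'"
    unfolding Delta_altdet by (rule altdet_permute) (use p in \<open>simp add: atLeast0LessThan\<close>)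
  finally show ?thesis by blast
qed

lemma Delta_swap:
  assumes "i < length D" "j < length D" "i \<noteq> j"
  shows "Delta (D[i := D ! j, j := D ! i]) = - Delta D"
proof -
  let ?p = "transpose i j"
  have "Delta (D[i := D ! j, j := D ! i]) = altdet (length D) (\<lambda>k. xymono (D ! ?p k))"
    unfolding Delta_altdet length_list_update
    by (rule altdet_cong) (use assms in \<open>auto simp: nth_list_update transpose_def\<close>)
  also have "\<dots> = signof ?p * Delta D"
    unfolding Delta_altdet by (rule altdet_permute) (use assms in \<open>auto intro: permutes_swap_id\<close>)
  finally show ?thesis using assms by (simp add: sign_swap_id)
qed

section \<open>Partition types as sums over blocks\<close>

fun xyvar_code :: "xyvar \<Rightarrow> nat" where
  "xyvar_code (XV i) = 2 * i"
| "xyvar_code (YV i) = 2 * i + 1"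

lemma xyvar_code_inject: "xyvar_code u = xyvar_code v \<Longrightarrow> u = v"
proof (cases u; cases v)
  fix i j assume "xyvar_code u = xyvar_code v" "u = XV i" "v = YV j"
  then show "u = v" by simp presburger
next
  fix i j assume "xyvar_code u = xyvar_code v" "u = YV i" "v = XV j"
  then show "u = v" by simp presburger
qed simp_all

text \<open>The order itself has no meaning here. That there is a linear order makes the polynomial ring an
  instance of \<open>idom\<close>, so that an entry of a staircase form vanishes only if one of its factors does.\<close>
instantiation xyvar :: linorder
begin

definition less_eq_xyvar :: "xyvar \<Rightarrow> xyvar \<Rightarrow> bool" where
  "u \<le> v \<longleftrightarrow> xyvar_code u \<le> xyvar_code v"

definition less_xyvar :: "xyvar \<Rightarrow> xyvar \<Rightarrow> bool" where
  "u < v \<longleftrightarrow> xyvar_code u < xyvar_code v"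

instance
  by standard (auto simp: less_eq_xyvar_def less_xyvar_def dest: xyvar_code_inject)

end

lemma single_inject:
  "c \<noteq> 0 \<Longrightarrow> Poly_Mapping.single a c = Poly_Mapping.single b c \<longleftrightarrow> a = b"
  by (metis keys_single singleton_inject)

lemma xvar_inject: "xvar i = xvar j \<longleftrightarrow> i = j"
  by (simp add: xvar_def single_inject)

lemma yvar_inject: "yvar i = yvar j \<longleftrightarrow> i = j"
  by (simp add: yvar_def single_inject)

lemma staircase_entry_nonzero_iff:
  assumes "staircase_form D S" "i < length D" "j < length D"
  shows "S $$ (i, j) \<noteq> 0 \<longleftrightarrow> pt_deg (D ! j) \<le> i"
proof -
  obtain c where c: "\<forall>i < length D. \<forall>j < length D.
        S $$ (i, j) =
          (if i < pt_deg (D ! j) then 0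
           else \<Prod>l < pt_deg (D ! j). if c i j l then xvar i - xvar l else yvar i - yvar l)"
    using assms(1) unfolding staircase_form_def by blast
  have "(\<Prod>l < pt_deg (D ! j). if c i j l then xvar i - xvar l else yvar i - yvar l) \<noteq> 0"
    if "pt_deg (D ! j) \<le> i"
    using that by (auto simp: xvar_inject yvar_inject)
  then show ?thesis using c assms by auto
qed

text \<open>Applied to the starts of the blocks and the number of columns, this lists the blocks as
  half-open index intervals.\<close>
definition consecutive :: "nat list \<Rightarrow> nat \<Rightarrow> (nat \<times> nat) list" where
  "consecutive xs b = zip xs (tl xs @ [b])"

lemma consecutive_append:
  assumes "ys \<noteq> []"
  shows "consecutive (xs @ ys) b = consecutive xs (hd ys) @ consecutive ys b"
proof (cases "xs = []")
  case False
  have "tl (xs @ ys) @ [b] = (tl xs @ [hd ys]) @ (tl ys @ [b])"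
    using False assms by simp
  show ?thesis
    unfolding consecutive_def \<open>tl (xs @ ys) @ [b] = _\<close> by (rule zip_append) (use False in simp)
qed (simp add: consecutive_def)

lemma consecutive_mem:
  "(r, r') \<in> set (consecutive xs b) \<Longrightarrow> r \<in> set xs \<and> r' \<in> insert b (set xs)"
  unfolding consecutive_def by (cases xs) (auto dest: set_zip_leftD set_zip_rightD)

lemma last_consecutive: "xs \<noteq> [] \<Longrightarrow> last (consecutive xs b) = (last xs, b)"
  unfolding consecutive_def by (subst last_zip) auto

text \<open>Here \<open>e j\<close> stands for \<open>j - pt_deg (D ! j)\<close>, the number of nonzero entries above the diagonal in
  column \<open>j\<close> of a staircase form. A block starts where \<open>e\<close> vanishes, and the number of nonzero
  entries above its diagonal is the sum of \<open>e\<close> over the block. The interval is a parameter so that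
  a partition type can be computed piece by piece.\<close>
definition block_sums :: "(nat \<Rightarrow> nat) \<Rightarrow> nat \<Rightarrow> nat \<Rightarrow> nat multiset" where
  "block_sums e a b = filter_mset (\<lambda>k. 0 < k)
     (mset (map (\<lambda>(r, r'). sum e {r..<r'}) (consecutive (filter (\<lambda>j. e j = 0) [a..<b]) b)))"

lemma block_sums_split:
  assumes "a \<le> c" "c < b" "e c = 0"
  shows "block_sums e a b = block_sums e a c + block_sums e c b"
proof -
  let ?f = "filter (\<lambda>j. e j = 0)"
  have up: "[c..<b] = c # [Suc c..<b]" using assms by (simp add: upt_conv_Cons)
  have "[a..<b] = [a..<c] @ [c..<b]"
    using assms upt_add_eq_append[of a c "b - c"] by simp
  then have "consecutive (?f [a..<b]) b = consecutive (?f [a..<c]) c @ consecutive (?f [c..<b]) b"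
    using consecutive_append[of "?f [c..<b]" "?f [a..<c]" b] assms by (simp add: up)
  then show ?thesis by (simp add: block_sums_def)
qed

lemma block_sums_cong:
  assumes "\<And>j. a \<le> j \<Longrightarrow> j < b \<Longrightarrow> e j = e' j"
  shows "block_sums e a b = block_sums e' a b"
proof -
  have f: "filter (\<lambda>j. e j = 0) [a..<b] = filter (\<lambda>j. e' j = 0) [a..<b]"
    by (rule filter_cong) (use assms in auto)
  show ?thesis
    unfolding block_sums_def f using assms
    by (intro arg_cong[of _ _ "filter_mset _"] arg_cong[of _ _ mset] map_cong refl)
      (auto dest!: consecutive_mem intro!: sum.cong)
qed

lemma block_sums_single:
  assumes "a < b" "e a = 0" "\<And>j. a < j \<Longrightarrow> j < b \<Longrightarrow> 0 < e j"
  shows "block_sums e a b = (if sum e {a..<b} = 0 then {#} else {# sum e {a..<b} #})"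
proof -
  have "filter (\<lambda>j. e j = 0) [a..<b] = [a]"
    using assms by (subst upt_conv_Cons) (auto simp: filter_empty_conv)
  then show ?thesis by (simp add: block_sums_def consecutive_def)
qed

lemma block_sums_zeros:
  assumes "\<And>j. a \<le> j \<Longrightarrow> j < b \<Longrightarrow> e j = 0"
  shows "block_sums e a b = {#}"
  unfolding block_sums_def using assms
  by (auto dest!: consecutive_mem)

lemma sum_block_sums:
  "a < b \<Longrightarrow> e a = 0 \<Longrightarrow> sum_mset (block_sums e a b) = sum e {a..<b}"
proof (induction b rule: less_induct)
  case (less b)
  define c where "c = Max {j \<in> {a..<b}. e j = 0}"
  have ne: "{j \<in> {a..<b}. e j = 0} \<noteq> {}" using less.prems by auto
  have c: "a \<le> c" "c < b" "e c = 0"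
    using Max_in[OF _ ne] unfolding c_def by auto
  have after: "0 < e j" if "c < j" "j < b" for j
  proof (rule ccontr)
    assume "\<not> 0 < e j"
    then have "j \<le> c"
      unfolding c_def using that c by (intro Max_ge) auto
    with that show False by simp
  qed
  have "sum_mset (block_sums e a c) = sum e {a..<c}"
    using less.IH[of c] less.prems c by (cases "a < c") (auto simp: block_sums_zeros)
  moreover have "sum_mset (block_sums e c b) = sum e {c..<b}"
    using c after by (subst block_sums_single) auto
  ultimately show ?case
    using block_sums_split[of a c b e] c sum.atLeastLessThan_concat[of a c b e] by simp
qed

lemma lower_partition_split_part:
  assumes "1 < size \<nu>"
  shows "lower_partition (\<mu> + \<nu>) (\<mu> + {#sum_mset \<nu>#})"
proof -
  have "\<nu> \<noteq> {#sum_mset \<nu>#}"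
    using assms by (metis less_irrefl size_single)
  moreover have "sum_mset (image_mset (\<lambda>k. {#k#}) \<mu> + {#\<nu>#}) = \<mu> + \<nu>"
    by (induction \<mu>) auto
  moreover have "image_mset sum_mset (image_mset (\<lambda>k. {#k#}) \<mu> + {#\<nu>#}) = \<mu> + {#sum_mset \<nu>#}"
    by (simp add: multiset.map_comp o_def)
  ultimately show ?thesis
    unfolding lower_partition_def by (intro conjI exI[of _ "image_mset (\<lambda>k. {#k#}) \<mu> + {#\<nu>#}"]) auto
qed

text \<open>Suppose \<open>k - 1\<close> of the \<open>w\<close> nonzero entries above the diagonal of the last block move to the
  chain of blocks of size 1 at the beginning, where they form the block \<open>{1..k}\<close>. If \<open>k \<le> w\<close>, some of
  them stay behind, so the part \<open>w\<close> has been split into at least two parts.\<close>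
lemma lower_partition_transfer:
  fixes e e' :: "nat \<Rightarrow> nat"
  assumes r: "r < n" "e r = 0" "\<And>j. r < j \<Longrightarrow> j < n \<Longrightarrow> 0 < e j" "sum e {r..<n} = w"
    and head: "\<And>j. j \<le> w + 2 \<Longrightarrow> e j = 0" "w + 2 \<le> r"
    and k: "2 \<le> k" "k \<le> w"
    and e': "e' 0 = 0" "e' 1 = 0" "\<And>j. 2 \<le> j \<Longrightarrow> j \<le> k \<Longrightarrow> e' j = 1"
      "\<And>j. k < j \<Longrightarrow> j < r \<Longrightarrow> e' j = e j" "e' r = 0" "sum e' {0..<n} = sum e {0..<n}"
  shows "lower_partition (block_sums e' 0 n) (block_sums e 0 n)"
proof -
  let ?M = "block_sums e (k + 1) r" and ?R = "block_sums e' r n"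
  have ek: "e (k + 1) = 0" and e'k: "e' (k + 1) = 0"
    using head(1)[of "k + 1"] head(2) k e'(4)[of "k + 1"] by auto
  have M: "block_sums e' (k + 1) r = ?M"
    by (rule block_sums_cong) (use e' in auto)
  have "{1..<k + 1} = insert 1 {2..k}" using k by auto
  then have sum1: "sum e' {1..<k + 1} = k - 1" using e' by simp
  have B1: "block_sums e' 1 (k + 1) = {#k - 1#}"
    using k e' sum1 by (subst block_sums_single) auto
  have "block_sums e' 0 n = block_sums e' 0 1 + block_sums e' 1 n"
    using e' r k head by (intro block_sums_split) auto
  also have "block_sums e' 0 1 = {#}"
    by (rule block_sums_zeros) (use e' in auto)
  also have "block_sums e' 1 n = block_sums e' 1 (k + 1) + block_sums e' (k + 1) n"
    using e'k r k head by (intro block_sums_split) auto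
  also have "block_sums e' (k + 1) n = block_sums e' (k + 1) r + ?R"
    using e' r k head by (intro block_sums_split) auto
  finally have lhs: "block_sums e' 0 n = ?M + ({#k - 1#} + ?R)"
    unfolding M B1 by simp
  have "block_sums e 0 n = block_sums e 0 (k + 1) + block_sums e (k + 1) n"
    using ek r k head by (intro block_sums_split) auto
  also have "block_sums e 0 (k + 1) = {#}"
    by (rule block_sums_zeros) (use head k in auto)
  also have "block_sums e (k + 1) n = ?M + block_sums e r n"
    using r k head by (intro block_sums_split) auto
  also have "block_sums e r n = {#w#}"
    using r k by (subst block_sums_single) auto
  finally have rhs: "block_sums e 0 n = ?M + {#w#}" by simp
  have cat: "sum f {0..<n} = sum f {0..<k + 1} + (sum f {k + 1..<r} + sum f {r..<n})"
    for f :: "nat \<Rightarrow> nat"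
  proof -
    have "sum f {0..<n} = sum f {0..<k + 1} + sum f {k + 1..<n}"
      by (rule sum.atLeastLessThan_concat[symmetric]) (use k head r in auto)
    also have "sum f {k + 1..<n} = sum f {k + 1..<r} + sum f {r..<n}"
      by (rule sum.atLeastLessThan_concat[symmetric]) (use k head r in auto)
    finally show ?thesis .
  qed
  have "sum e' {0..<n} = sum e' {0..<k + 1} + (sum e' {k + 1..<r} + sum e' {r..<n})"
    by (rule cat)
  also have "sum e' {0..<k + 1} = k - 1"
    using sum1 e' by (subst sum.atLeast_Suc_lessThan) auto
  also have "sum e' {k + 1..<r} = sum e {k + 1..<r}"
    by (rule sum.cong) (use e' in auto)
  finally have t': "sum e' {0..<n} = k - 1 + (sum e {k + 1..<r} + sum e' {r..<n})" .
  have "sum e {0..<n} = sum e {0..<k + 1} + (sum e {k + 1..<r} + sum e {r..<n})"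
    by (rule cat)
  also have "sum e {0..<k + 1} = 0" using head k by auto
  finally have "k - 1 + sum e' {r..<n} = w" using t' e'(6) r(4) by simp
  then have total: "k - 1 + sum_mset ?R = w"
    using sum_block_sums[of r n e'] r e' by simp
  then have "?R \<noteq> {#}" using k by auto
  then have "1 < size ({#k - 1#} + ?R)"
    by (metis add.commute less_add_same_cancel2 nonempty_has_size size_single size_union)
  then have "lower_partition (?M + ({#k - 1#} + ?R)) (?M + {#sum_mset ({#k - 1#} + ?R)#})"
    by (rule lower_partition_split_part)
  then show ?thesis using total by (simp add: lhs rhs)
qed

lemma nonzeros_above_diag_block:
  assumes S: "staircase_form D S" and r: "pt_deg (D ! r) = r" and r': "r' \<le> length D"
  shows "nonzeros_above_diag (mat (r' - r) (r' - r) (\<lambda>(i, j). S $$ (r + i, r + j)))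
    = (\<Sum>j = r..<r'. j - pt_deg (D ! j))"
proof -
  let ?B = "mat (r' - r) (r' - r) (\<lambda>(i, j). S $$ (r + i, r + j))"
  let ?N = "{(i, j). i < dim_row ?B \<and> j < dim_col ?B \<and> i < j \<and> ?B $$ (i, j) \<noteq> 0}"
  have ge: "r \<le> pt_deg (D ! j)" if "r \<le> j" "j < r'" for j
    using S that r r' sorted_nth_mono[of "map pt_deg D" r j] by (simp add: staircase_form_def)
  have nz: "S $$ (r + i, r + j) \<noteq> 0 \<longleftrightarrow> pt_deg (D ! (r + j)) \<le> r + i"
    if "i < r' - r" "j < r' - r" for i j
    using staircase_entry_nonzero_iff[OF S, of "r + i" "r + j"] that r' by auto
  have "bij_betw (\<lambda>(i, j). (r + j, r + i)) ?N (SIGMA j:{r..<r'}. {pt_deg (D ! j)..<j})"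
  proof (rule bij_betw_byWitness[where f' = "\<lambda>(j, i). (i - r, j - r)"])
    show "(\<lambda>(i, j). (r + j, r + i)) ` ?N \<subseteq> (SIGMA j:{r..<r'}. {pt_deg (D ! j)..<j})"
      using nz by auto
    show "(\<lambda>(j, i). (i - r, j - r)) ` (SIGMA j:{r..<r'}. {pt_deg (D ! j)..<j}) \<subseteq> ?N"
    proof clarify
      fix j i assume j: "j \<in> {r..<r'}" and i: "i \<in> {pt_deg (D ! j)..<j}"
      have "r \<le> i" using ge[of j] i j by simp
      then show "i - r < dim_row ?B \<and> j - r < dim_col ?B \<and> i - r < j - r \<and> ?B $$ (i - r, j - r) \<noteq> 0"
        using i j nz[of "i - r" "j - r"] by auto
    qed
    show "\<forall>a\<in>SIGMA j:{r..<r'}. {pt_deg (D ! j)..<j}.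
        (case case a of (j, i) \<Rightarrow> (i - r, j - r) of (i, j) \<Rightarrow> (r + j, r + i)) = a"
      using ge by fastforce
  qed auto
  then have "card ?N = card (SIGMA j:{r..<r'}. {pt_deg (D ! j)..<j})"
    by (rule bij_betw_same_card)
  then show ?thesis unfolding nonzeros_above_diag_def by simp
qed

lemma blocks_consecutive:
  "blocks D S = map (\<lambda>(r, r'). mat (r' - r) (r' - r) (\<lambda>(i, j). S $$ (r + i, r + j)))
     (consecutive (block_starts D) (length D))"
  by (simp add: blocks_def consecutive_def)

lemma partition_type_block_sums:
  assumes S: "staircase_form D S" and le: "\<And>j. j < length D \<Longrightarrow> pt_deg (D ! j) \<le> j"
  shows "partition_type D S = block_sums (\<lambda>j. j - pt_deg (D ! j)) 0 (length D)"
proof -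
  let ?e = "\<lambda>j. j - pt_deg (D ! j)"
  have st: "block_starts D = filter (\<lambda>j. ?e j = 0) [0..<length D]"
    unfolding block_starts_def by (rule filter_cong) (use le in fastforce)+
  have "map nonzeros_above_diag (blocks D S)
      = map (\<lambda>(r, r'). sum ?e {r..<r'}) (consecutive (block_starts D) (length D))"
    unfolding blocks_consecutive map_map o_def
    by (rule map_cong[OF refl])
      (auto simp: block_starts_def intro!: nonzeros_above_diag_block[OF S] dest!: consecutive_mem)
  then show ?thesis
    unfolding partition_type_def block_sums_def st by simp
qed

lemma last_block:
  assumes "block_starts D \<noteq> []"
  shows "last (blocks D S) = mat (length D - last (block_starts D)) (length D - last (block_starts D))
    (\<lambda>(i, j). S $$ (last (block_starts D) + i, last (block_starts D) + j))"
proof -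
  have "consecutive (block_starts D) (length D) \<noteq> []"
    using assms by (auto simp: consecutive_def)
  then show ?thesis
    by (simp add: blocks_consecutive last_map last_consecutive[OF assms])
qed

text \<open>The degree bound says that the factors involve the \<open>n\<close> available points only.\<close>
lemma staircase_form_exists:
  assumes "sorted (map pt_deg D)" "\<And>j. j < length D \<Longrightarrow> pt_deg (D ! j) \<le> length D"
  shows "\<exists>S. staircase_form D S"
proof -
  let ?n = "length D"
  let ?C = "\<lambda>j. staircol (trunc_var ?n xvar) (trunc_var ?n yvar) (D ! j)"
  let ?S = "mat ?n ?n (\<lambda>(i, j). ?C j i)"
  have "det ?S - Delta D \<in> low_degree_ideal ?n (total_deg D)"
    using altdet_monic_cols[of D ?n ?C] monic_col_trunc_staircol by (simp add: altdet_def)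
  moreover have "?S $$ (i, j) = (if i < pt_deg (D ! j) then 0
           else \<Prod>l < pt_deg (D ! j). if l < fst (D ! j) then xvar i - xvar l else yvar i - yvar l)"
    if "i < ?n" "j < ?n" for i j
    using that assms(2)[of j] trunc_staircol_zero[of i ?n "D ! j"]
    by (auto simp: staircol_def trunc_var_def intro!: prod.cong)
  ultimately have "staircase_form D ?S"
    unfolding staircase_form_def using assms(1)
    by (intro conjI exI[of _ "\<lambda>i j l. l < fst (D ! j)"]) auto
  then show ?thesis ..
qed

section \<open>Trading a factor between two columns\<close>

text \<open>Let \<open>E\<close> be \<open>D\<close> with its \<open>m\<close>-th point \<open>(0,1) + q\<close> replaced by \<open>(0,1)\<close>, and raise the
  first \<open>M\<close> points of \<open>E\<close> in turn by \<open>q\<close>. Raising \<open>(0,1)\<close> at position \<open>m\<close> restores \<open>D\<close>.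
  Raising \<open>(1,0)\<close> at position 1 yields the traded sequence with two points exchanged, hence the
  sign. Raising the point of degree 0 leaves no point of degree 0, so this term vanishes.\<close>
lemma trade_sum_low:
  assumes n: "length D = n" and m: "1 < m" "m < M" "M \<le> n"
    and D1: "D ! 1 = (1, 0)" and Dm: "D ! m = padd (0, 1) q" and q: "0 < pt_deg q"
    and pos: "\<And>j. 0 < j \<Longrightarrow> j < n \<Longrightarrow> 0 < pt_deg (D ! j)"
    and bottom: "\<And>j. M \<le> j \<Longrightarrow> j < n \<Longrightarrow> M \<le> pt_deg (D ! j)"
  shows "Delta D - Delta (D[1 := (0, 1), m := padd (1, 0) q])
      + (\<Sum>k\<in>{2..<M} - {m}. Delta (D[m := (0, 1), k := padd (D ! k) q]))
    \<in> low_degree_ideal n (total_deg D)"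
proof -
  let ?L = "low_degree_ideal n (total_deg D)"
  note L = low_degree_ideal[of n "total_deg D"]
  define E where "E = D[m := (0, 1)]"
  define T where "T k = Delta (E[k := padd (E ! k) q])" for k
  have nE: "length E = n" by (simp add: E_def n)
  have deg_E: "total_deg E + pt_deg q = total_deg D"
    using total_deg_update[of m D "(0, 1)"] n m Dm by (simp add: E_def)
  have all: "sum T {..<M} \<in> ?L"
    using sum_raised_low[OF nE m(3) _ q] bottom m unfolding T_def deg_E by (auto simp: E_def)
  have T0: "T 0 \<in> ?L"
  proof -
    let ?E0 = "E[0 := padd (E ! 0) q]"
    have "total_deg ?E0 = total_deg D"
      using total_deg_update[of 0 E "padd (E ! 0) q"] m nE deg_E by simp
    moreover have "Delta ?E0 \<in> low_degree_ideal n (total_deg ?E0)"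
    proof (rule Delta_low_if_crowded[of _ n "{..<n}" 1])
      fix j assume "j \<in> {..<n}"
      then show "1 \<le> pt_deg (?E0 ! j)"
        using pos[of j] q m n by (auto simp: E_def nth_list_update)
    qed (use nE m in auto)
    ultimately show ?thesis by (simp add: T_def)
  qed
  have T1: "T 1 = - Delta (D[1 := (0, 1), m := padd (1, 0) q])"
  proof -
    let ?E1 = "E[1 := padd (1, 0) q]"
    have "Delta (?E1[1 := ?E1 ! m, m := ?E1 ! 1]) = - Delta ?E1"
      by (rule Delta_swap) (use m nE in auto)
    moreover have "?E1[1 := ?E1 ! m, m := ?E1 ! 1] = D[1 := (0, 1), m := padd (1, 0) q]"
      using m n by (auto simp: E_def nth_list_update intro!: nth_equalityI)
    moreover have "E ! 1 = (1, 0)" using m D1 by (simp add: E_def)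
    ultimately show ?thesis by (simp add: T_def)
  qed
  have "E[m := padd (E ! m) q] = D"
    using m n Dm by (auto simp: E_def nth_list_update intro!: nth_equalityI)
  then have Tm: "T m = Delta D" by (simp add: T_def)
  have Tk: "T k = Delta (D[m := (0, 1), k := padd (D ! k) q])" if "k \<in> {2..<M} - {m}" for k
    using that by (simp add: T_def E_def)
  define R where "R = {2..<M} - {m}"
  have "finite R" "0 \<notin> R" "1 \<notin> R" "m \<notin> R" by (auto simp: R_def)
  moreover have "{..<M} = insert 0 (insert 1 (insert m R))" using m by (auto simp: R_def)
  ultimately have "sum T {..<M} = T 0 + (T 1 + (T m + sum T ({2..<M} - {m})))"
    using m by (simp flip: R_def)
  moreover have "sum T ({2..<M} - {m})
      = (\<Sum>k\<in>{2..<M} - {m}. Delta (D[m := (0, 1), k := padd (D ! k) q]))"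
    by (rule sum.cong) (use Tk in auto)
  ultimately have "sum T {..<M} - T 0 = Delta D - Delta (D[1 := (0, 1), m := padd (1, 0) q])
      + (\<Sum>k\<in>{2..<M} - {m}. Delta (D[m := (0, 1), k := padd (D ! k) q]))"
    unfolding T1 Tm by simp
  with xy_ideal_diff[OF L all T0] show ?thesis by simp
qed

lemma Delta_low_if_above_staircase:
  assumes "length D = n" "sorted (map pt_deg D)" "j < n" "j < pt_deg (D ! j)"
  shows "Delta D \<in> low_degree_ideal n (total_deg D)"
proof (rule Delta_low_if_crowded[of _ n "{j..<n}" "Suc j"])
  fix i assume "i \<in> {j..<n}"
  then show "Suc j \<le> pt_deg (D ! i)"
    using assms sorted_nth_mono[of "map pt_deg D" j i] by simp
qed (use assms in auto)

text \<open>Either some degree exceeds its index and \<open>Delta_low_if_above_staircase\<close> applies, or a staircase form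
  exists, which is congruent to the alternant and whose determinant is zero or a generator.\<close>
lemma Delta_in_lower:
  assumes L: "ideal L (xy_ring n)" "low_degree_ideal n (total_deg D') \<subseteq> L"
    and n: "length D' = n" and sorted: "sorted (map pt_deg D')"
    and gen: "\<And>S'. staircase_form D' S' \<Longrightarrow> det S' \<noteq> 0 \<Longrightarrow>
      (\<And>j. j < n \<Longrightarrow> pt_deg (D' ! j) \<le> j) \<Longrightarrow> det S' \<in> L"
  shows "Delta D' \<in> L"
proof (cases "\<forall>j<n. pt_deg (D' ! j) \<le> j")
  case False
  then show ?thesis
    using Delta_low_if_above_staircase[OF n sorted] L(2) by (auto simp: not_le)
next
  case True
  then have "\<exists>S'. staircase_form D' S'"
    by (intro staircase_form_exists sorted) (use n in force)
  then obtain S' where S': "staircase_form D' S'" ..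
  then have "det S' - Delta D' \<in> L"
    using L(2) n by (auto simp: staircase_form_def)
  moreover have "det S' \<in> L"
    using gen[OF S'] True xy_ideal_0[OF L(1)] by (cases "det S' = 0") auto
  ultimately have "det S' - (det S' - Delta D') \<in> L"
    by (rule xy_ideal_diff[OF L(1), rotated])
  then show ?thesis by simp
qed

lemma mset_update_add:
  "i < length xs \<Longrightarrow> add_mset (xs ! i) (mset (xs[i := x])) = add_mset x (mset xs)"
  by (simp add: mset_update)

text \<open>A last block of size \<open>n - r\<close> has at least \<open>n - r - 1\<close> nonzero entries above the diagonal, with equality
  only if each of its columns after the first has exactly one, that is, if the block is minimal.\<close>
lemma sum_excess_ge:
  fixes e :: "nat \<Rightarrow> nat"
  assumes "r < n" "\<And>j. r < j \<Longrightarrow> j < n \<Longrightarrow> 0 < e j"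
  shows "n \<le> sum e {r..<n} + r + 1"
    and "r < j \<Longrightarrow> j < n \<Longrightarrow> 2 \<le> e j \<Longrightarrow> n \<le> sum e {r..<n} + r"
proof -
  have sub: "sum e {Suc r..<n} \<le> sum e {r..<n}"
    by (rule sum_mono2) auto
  have one: "(\<Sum>j = Suc r..<n. 1) \<le> sum e {Suc r..<n}"
    by (rule sum_mono) (use assms(2) in \<open>simp add: Suc_le_eq\<close>)
  from one sub show "n \<le> sum e {r..<n} + r + 1" by simp
  assume j: "r < j" "j < n" "2 \<le> e j"
  have "(\<Sum>j = Suc r..<n. 1) < sum e {Suc r..<n}"
  proof (rule sum_strict_mono_ex1)
    show "\<forall>j\<in>{Suc r..<n}. 1 \<le> e j" using assms(2) by (simp add: Suc_le_eq)
    show "\<exists>j\<in>{Suc r..<n}. 1 < e j" by (rule bexI[of _ j]) (use j in auto)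
  qed simp
  with sub show "n \<le> sum e {r..<n} + r" by simp
qed

text \<open>The situation of the theorem when no degree exceeds its index: \<open>r\<close> is the start of the last
  block, \<open>w\<close> the number of nonzero entries above its diagonal, and the points up to index
  \<open>w + 2\<close> start blocks of their own.\<close>
context
  fixes D :: "(nat \<times> nat) list" and n r w :: nat
  assumes n: "length D = n" and sorted: "sorted (map pt_deg D)"
    and le: "\<And>j. j < n \<Longrightarrow> pt_deg (D ! j) \<le> j"
    and r: "r < n" "pt_deg (D ! r) = r" "\<And>j. r < j \<Longrightarrow> j < n \<Longrightarrow> pt_deg (D ! j) < j"
    and w: "(\<Sum>j = r..<n. j - pt_deg (D ! j)) = w"
    and head: "\<And>i. i \<le> w + 2 \<Longrightarrow> pt_deg (D ! i) = i" "w + 2 \<le> r" "1 \<le> w"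
    and D1: "D ! 1 = (1, 0)"
begin

lemma pt_deg_mono: "i \<le> j \<Longrightarrow> j < n \<Longrightarrow> pt_deg (D ! i) \<le> pt_deg (D ! j)"
  using sorted_nth_mono[OF sorted, of i j] n by simp

lemma pt_deg_pos: "0 < j \<Longrightarrow> j < n \<Longrightarrow> 0 < pt_deg (D ! j)"
  using pt_deg_mono[of 1 j] head(1)[of 1] by simp

text \<open>A factor can be traded between two columns inside the initial chain of blocks of size 1 with
  no error of lower partition type. The point of index \<open>w + 2\<close> still has degree \<open>w + 2\<close>, so raising
  can be restricted to the points up to \<open>w + 1\<close>; raising one of degree \<open>k\<close> strictly between 1 and
  \<open>w + 1\<close> gives it degree \<open>k + w\<close>, which makes the columns of degree at least \<open>w + 2\<close> too many.\<close>
lemma trade_in_chain_low: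
  assumes q: "D ! (w + 1) = padd (0, 1) q"
  shows "Delta D - Delta (D[1 := (0, 1), w + 1 := padd (1, 0) q])
    \<in> low_degree_ideal n (total_deg D)"
proof -
  let ?L = "low_degree_ideal n (total_deg D)"
  note L = low_degree_ideal[of n "total_deg D"]
  let ?T = "\<lambda>k. D[w + 1 := (0, 1), k := padd (D ! k) q]"
  have degq: "pt_deg q = w"
    using q head(1)[of "w + 1"] by simp
  have wn: "w + 2 < n" using head r by simp
  have bottom: "w + 2 \<le> pt_deg (D ! j)" if "w + 2 \<le> j" "j < n" for j
    using pt_deg_mono[OF that] head(1)[of "w + 2"] by simp
  have "Delta D - Delta (D[1 := (0, 1), w + 1 := padd (1, 0) q])
      + (\<Sum>k\<in>{2..<w + 2} - {w + 1}. Delta (?T k)) \<in> ?L"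
    by (rule trade_sum_low)
      (use n head D1 q degq wn pt_deg_pos bottom in auto)
  moreover have "Delta (?T k) \<in> ?L" if k: "k \<in> {2..<w + 2} - {w + 1}" for k
  proof -
    have "total_deg (?T k) = total_deg D"
      using total_deg_update[of "w + 1" D "(0, 1)"] k wn n head(1)[of "w + 1"] degq
        total_deg_update[of k "D[w + 1 := (0, 1)]" "padd (D ! k) q"]
      by simp
    moreover have "Delta (?T k) \<in> low_degree_ideal n (total_deg (?T k))"
    proof (rule Delta_low_if_crowded[of _ n "insert k {w + 2..<n}" "w + 2"])
      fix j assume "j \<in> insert k {w + 2..<n}"
      then show "w + 2 \<le> pt_deg (?T k ! j)"
        using k wn n head(1)[of k] degq bottom[of j] by (auto simp: nth_list_update)
    qed (use k wn n in auto)
    ultimately show ?thesis by simp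
  qed
  then have "(\<Sum>k\<in>{2..<w + 2} - {w + 1}. Delta (?T k)) \<in> ?L"
    by (rule xy_ideal_sum[OF L])
  ultimately show ?thesis
    using xy_ideal_diff[OF L] by fastforce
qed

text \<open>Removing the point of index \<open>k\<close> from the chain and inserting \<open>(0,1)\<close> leaves the degrees
  \<open>0, 1, 1, 2, \<dots>, k - 1\<close> in front, a block with \<open>k - 1\<close> nonzero entries above the diagonal. The last
  block loses as many, since the degree of its \<open>m\<close>-th point grows by \<open>k - 1\<close>.
  The sorted sequence \<open>D'\<close> is built explicitly from the new first \<open>r\<close> points \<open>A\<close> and the new last
  block \<open>Z\<close>; only \<open>Z\<close> has to be sorted anew, and the blocks between are those of \<open>D\<close>.\<close>
lemma transfer_term_in_lower:
  fixes L :: "xypoly set"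
  assumes L: "ideal L (xy_ring n)" "low_degree_ideal n (total_deg D) \<subseteq> L"
    and gen: "\<And>D' S'. length D' = n \<Longrightarrow> staircase_form D' S' \<Longrightarrow> det S' \<noteq> 0 \<Longrightarrow>
      lower_partition (partition_type D' S') (block_sums (\<lambda>j. j - pt_deg (D ! j)) 0 n) \<Longrightarrow> det S' \<in> L"
    and m: "r \<le> m" "m < n" and q: "pt_deg (D ! m) = pt_deg q + 1" and k: "2 \<le> k" "k \<le> w"
  shows "Delta (D[m := (0, 1), k := padd (D ! k) q]) \<in> L"
proof -
  define X where "X = padd (D ! k) q"
  define E where "E = D[m := (0, 1), k := X]"
  define G where "G = take r D"
  define A where "A = take 2 G @ (0, 1) # take (k - 2) (drop 2 G) @ drop (Suc k) G"
  define Z where "Z = sort_key pt_deg ((drop r D)[m - r := X])"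
  define D' where "D' = A @ Z"
  have kr: "k < r" using k head by simp
  have lenG: "length G = r" using r n by (simp add: G_def)
  have lenA: "length A = r" using lenG k kr by (simp add: A_def)
  have lenZ: "length Z = n - r" using n by (simp add: Z_def)
  have n': "length D' = n" using lenA lenZ r by (simp add: D'_def)
  have nthG: "j < r \<Longrightarrow> G ! j = D ! j" for j by (simp add: G_def)
  have deg_A: "pt_deg (A ! j) = (if j < 2 then j else if j \<le> k then j - 1 else pt_deg (D ! j))"
    if "j < r" for j
  proof -
    have "A ! j = (if j < 2 then D ! j else if j = 2 then (0, 1)
        else if j \<le> k then D ! (j - 1) else D ! j)"
    proof -
      consider "j < 2" | "j = 2" | "2 < j" "j \<le> k" | "k < j" by linarith
      then show ?thesis
      proof cases
        case 3
        then obtain i where "j = i + 3" using le_Suc_ex[of 3 j] by (auto simp: add.commute)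
        with 3 show ?thesis
          using that kr lenG nthG[of "i + 2"] by (simp add: A_def nth_append add.commute less_diff_conv)
      next
        case 4
        then obtain i where "j = k + 1 + i" using le_Suc_ex[of "k + 1" j] by auto
        moreover obtain l where "k = l + 2" using k by (metis add.commute le_Suc_ex)
        ultimately show ?thesis using that kr lenG nthG[of j] by (simp add: A_def nth_append add.commute)
      qed (use that kr k lenG nthG in \<open>auto simp: A_def nth_append\<close>)
    qed
    then show ?thesis
      using head(1)[of j] head(1)[of "j - 1"] k that by (auto simp: pt_deg_def)
  qed
  have A_le: "pt_deg (A ! j) \<le> j" if "j < r" for j
    using deg_A[OF that] le[of j] that r by auto
  have degX: "r \<le> pt_deg X"
    using pt_deg_mono[OF m] r(2) q k head(1)[of k] by (simp add: X_def)
  have Z_ge: "r \<le> pt_deg z" if "z \<in> set Z" for z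
  proof -
    have "z \<in> set ((drop r D)[m - r := X])" using that by (simp add: Z_def)
    then have "z \<in> insert X (set (drop r D))" using set_update_subset_insert by fast
    moreover have "r \<le> pt_deg (D ! (r + i))" if "i < n - r" for i
      using pt_deg_mono[of r "r + i"] r(2) that by simp
    ultimately show ?thesis
      using degX n by (auto simp: in_set_conv_nth)
  qed
  have sorted_A: "sorted (map pt_deg A)"
    unfolding sorted_iff_nth_mono
  proof (intro allI impI)
    fix i j assume ij: "i \<le> j" "j < length (map pt_deg A)"
    then have "j < r" "i < r" using lenA by auto
    moreover have "pt_deg (D ! i) \<le> pt_deg (D ! j)" "k < j \<Longrightarrow> k \<le> pt_deg (D ! j)"
      using ij lenA r pt_deg_mono[of i j] pt_deg_mono[of k j] head(1)[of k] k by auto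
    ultimately show "map pt_deg A ! i \<le> map pt_deg A ! j"
      using ij lenA k by (auto simp: deg_A)
  qed
  have sorted': "sorted (map pt_deg D')"
  proof -
    have "pt_deg x \<le> pt_deg z" if "x \<in> set A" "z \<in> set Z" for x z
    proof -
      obtain j where "j < r" "x = A ! j" using \<open>x \<in> set A\<close> lenA by (auto simp: in_set_conv_nth)
      then show ?thesis using A_le[of j] Z_ge[OF that(2)] by simp
    qed
    then show ?thesis
      using sorted_A by (auto simp: D'_def sorted_append Z_def)
  qed
  have mset': "mset E = mset D'"
  proof -
    have "G = take k G @ G ! k # drop (Suc k) G"
      using kr lenG by (intro id_take_nth_drop) simp
    also have "take k G = take 2 G @ take (k - 2) (drop 2 G)"
      using take_add[of 2 "k - 2" G] by (simp only: le_add_diff_inverse[OF k(1)])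
    finally have "mset G = mset ((take 2 G @ take (k - 2) (drop 2 G)) @ G ! k # drop (Suc k) G)"
      by (rule arg_cong[of _ _ mset])
    then have 1: "add_mset (D ! k) (mset A) = add_mset (0, 1) (mset G)"
      using nthG[OF kr] by (simp add: A_def)
    have 2: "add_mset (D ! m) (mset Z) = add_mset X (mset (drop r D))"
      using mset_update_add[of "m - r" "drop r D" X] m n by (simp add: Z_def)
    have 3: "mset D = mset G + mset (drop r D)"
      by (simp add: G_def flip: mset_append)
    have "add_mset (D ! m) (add_mset (D ! k) (mset E)) = add_mset X (add_mset (0, 1) (mset D))"
      using mset_update_add[of k "D[m := (0, 1)]" X] mset_update_add[of m D "(0, 1)"] m n kr
      by (simp add: E_def add_mset_commute)
    also have "\<dots> = add_mset (0, 1) (mset G) + add_mset X (mset (drop r D))"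
      by (simp add: 3)
    also have "\<dots> = add_mset (D ! m) (add_mset (D ! k) (mset D'))"
      unfolding 1[symmetric] 2[symmetric] by (simp add: D'_def)
    finally show ?thesis by simp
  qed
  have deg': "total_deg D' = total_deg D"
  proof -
    have "total_deg E = total_deg D'"
      unfolding total_deg_def using mset' by (metis mset_map sum_mset_sum_list)
    moreover have "total_deg E = total_deg D"
      using total_deg_update[of m D "(0, 1)"] total_deg_update[of k "D[m := (0, 1)]" X] m n kr q
      by (simp add: E_def X_def)
    ultimately show ?thesis by simp
  qed
  have "Delta D' \<in> L"
  proof (rule Delta_in_lower[OF L(1) _ n' sorted'])
    show "low_degree_ideal n (total_deg D') \<subseteq> L" using L(2) deg' by simp
  next
    fix S' assume S': "staircase_form D' S'" "det S' \<noteq> 0"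
      and le': "\<And>j. j < n \<Longrightarrow> pt_deg (D' ! j) \<le> j"
    let ?e = "\<lambda>j. j - pt_deg (D ! j)" and ?e' = "\<lambda>j. j - pt_deg (D' ! j)"
    have nth': "D' ! j = A ! j" if "j < r" for j
      using that lenA by (simp add: D'_def nth_append)
    have "lower_partition (block_sums ?e' 0 n) (block_sums ?e 0 n)"
    proof (rule lower_partition_transfer)
      have "D' ! r \<in> set Z" using lenA lenZ r by (simp add: D'_def nth_append)
      then show "?e' r = 0" using Z_ge by simp
      have total: "sum (\<lambda>j. j - pt_deg (F ! j)) {0..<n} = sum id {0..<n} - total_deg F"
        if "\<And>j. j < n \<Longrightarrow> pt_deg (F ! j) \<le> j" "length F = n" for F
        unfolding total_deg_sum atLeast0LessThan that(2)
        by (subst sum_subtractf_nat[symmetric]) (use that in auto)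
      show "sum ?e' {0..<n} = sum ?e {0..<n}"
        using total[OF le' n'] total[OF le n] deg' by simp
      show "?e r = 0" using r(2) by simp
      show "0 < ?e j" if "r < j" "j < n" for j using r(3)[OF that] by simp
      show "?e j = 0" if "j \<le> w + 2" for j using head(1)[OF that] by simp
      show "?e' 0 = 0" "?e' 1 = 0" using nth'[of 0] nth'[of 1] deg_A[of 0] deg_A[of 1] k kr by simp_all
      show "?e' j = 1" if "2 \<le> j" "j \<le> k" for j
        using nth'[of j] deg_A[of j] that kr by simp
      show "?e' j = ?e j" if "k < j" "j < r" for j
        using nth'[of j] deg_A[of j] that k by simp
    qed (fact r(1) w head(2) k)+
    then show "det S' \<in> L"
      using gen[OF n' S'] partition_type_block_sums[OF S'(1)] le' n' by simp
  qed
  moreover obtain p where "Delta E = signof (p :: nat \<Rightarrow> nat) * Delta D'"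
    using Delta_mset_eq[OF mset'] by blast
  ultimately show ?thesis
    using xy_ideal_signof_mult[OF L(1)] unfolding E_def X_def by simp
qed

text \<open>Of the terms of \<open>trade_sum_low\<close> with \<open>M = n\<close>, those with \<open>2 \<le> k \<le> w\<close> have lower partition type, and
  those with \<open>k \<ge> w + 2\<close> contain a point of degree at least \<open>(w + 2) + (r - 1) \<ge> n\<close> and vanish.
  The term with \<open>k = w + 1\<close> remains: it moves all \<open>w\<close> entries at once and so keeps the partition type.
  The second part says when its degree is large enough for it to vanish as well.\<close>
lemma trade_with_last_block:
  fixes L :: "xypoly set"
  assumes L: "ideal L (xy_ring n)" "low_degree_ideal n (total_deg D) \<subseteq> L"
    and gen: "\<And>D' S'. length D' = n \<Longrightarrow> staircase_form D' S' \<Longrightarrow> det S' \<noteq> 0 \<Longrightarrow>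
      lower_partition (partition_type D' S') (block_sums (\<lambda>j. j - pt_deg (D ! j)) 0 n) \<Longrightarrow> det S' \<in> L"
    and m: "r \<le> m" "m < n" and q: "D ! m = padd (0, 1) q"
  shows "Delta D - Delta (D[1 := (0, 1), m := padd (1, 0) q])
    + Delta (D[m := (0, 1), w + 1 := padd (D ! (w + 1)) q]) \<in> L"
    and "n \<le> w + pt_deg (D ! m) \<Longrightarrow> Delta D - Delta (D[1 := (0, 1), m := padd (1, 0) q]) \<in> L"
proof -
  let ?T = "\<lambda>k. D[m := (0, 1), k := padd (D ! k) q]"
  have degq: "pt_deg (D ! m) = pt_deg q + 1" using q by simp
  have size_le: "n \<le> w + r + 1"
    unfolding w[symmetric] by (rule sum_excess_ge(1)) (use r in simp_all)
  have r_le: "r \<le> pt_deg q + 1" using pt_deg_mono[OF m] r(2) degq by simp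
  have zero: "Delta (?T k) \<in> L" if k: "k < n" "k \<noteq> m" "n \<le> pt_deg (D ! k) + pt_deg q" for k
  proof -
    have "total_deg (?T k) = total_deg D"
      using total_deg_update[of m D "(0, 1)"] k m n degq
        total_deg_update[of k "D[m := (0, 1)]" "padd (D ! k) q"]
      by simp
    moreover have "Delta (?T k) \<in> low_degree_ideal n (total_deg (?T k))"
      by (rule Delta_low_if_crowded[of _ n "{k}" n]) (use k n in auto)
    ultimately show ?thesis using L(2) by auto
  qed
  have "Delta D - Delta (D[1 := (0, 1), m := padd (1, 0) q])
      + (\<Sum>k\<in>{2..<n} - {m}. Delta (?T k)) \<in> low_degree_ideal n (total_deg D)"
    by (rule trade_sum_low) (use n m head D1 q r_le pt_deg_pos in auto)
  then have 1: "Delta D - Delta (D[1 := (0, 1), m := padd (1, 0) q])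
      + (\<Sum>k\<in>{2..<n} - {m}. Delta (?T k)) \<in> L" using L(2) by blast
  have "Delta (?T k) \<in> L" if k: "k \<in> {2..<n} - {m} - {w + 1}" for k
  proof (cases "k \<le> w")
    case True
    then show ?thesis
      using k by (intro transfer_term_in_lower[OF L gen m degq]) auto
  next
    case False
    then have "w + 2 \<le> pt_deg (D ! k)"
      using k pt_deg_mono[of "w + 2" k] head(1)[of "w + 2"] by auto
    then show ?thesis
      using k size_le r_le by (intro zero) auto
  qed
  then have "(\<Sum>k\<in>{2..<n} - {m} - {w + 1}. Delta (?T k)) \<in> L"
    by (rule xy_ideal_sum[OF L(1)])
  from xy_ideal_diff[OF L(1) 1 this]
  show 2: "Delta D - Delta (D[1 := (0, 1), m := padd (1, 0) q]) + Delta (?T (w + 1)) \<in> L"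
    using sum.remove[of "{2..<n} - {m}" "w + 1" "\<lambda>k. Delta (?T k)"] head r m
    by (simp add: algebra_simps)
  assume "n \<le> w + pt_deg (D ! m)"
  then have "Delta (?T (w + 1)) \<in> L"
    using head(1)[of "w + 1"] head r m degq by (intro zero) auto
  from xy_ideal_diff[OF L(1) 2 this]
  show "Delta D - Delta (D[1 := (0, 1), m := padd (1, 0) q]) \<in> L" by simp
qed

end

section \<open>The congruences\<close>

lemma det_staircase_carrier:
  assumes "staircase_form D S" "length D = n"
  shows "det S \<in> carrier (xy_ring n)"
proof -
  have "det S - Delta D \<in> carrier (xy_ring n)"
    using assms xy_ideal_carrier[OF low_degree_ideal] unfolding staircase_form_def by blast
  from xy_carrier_add[OF this Delta_carrier[OF assms(2)]] show ?thesis by simp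
qed

lemma lower_generators_carrier:
  assumes "length D = n"
  shows "low_degree_ideal n d \<union>
        {det S' | D' S'. length D' = n \<and> staircase_form D' S' \<and> det S' \<noteq> 0 \<and>
           lower_partition (partition_type D' S') \<mu>} \<subseteq> carrier (xy_ring n)"
  using xy_ideal_carrier[OF low_degree_ideal] det_staircase_carrier by auto

theorem lemma29:
  fixes D D_nw D_se :: "(nat \<times> nat) list"
    and S :: "xypoly mat"
    and n t\<^sub>0 j\<^sub>r t a b :: nat
  assumes "length D = n"
    and "sorted (map pt_deg D)"
    and "staircase_form D S"
    and "t\<^sub>0 = dim_row (last (blocks D S))"
    and "j\<^sub>r = nonzeros_above_diag (last (blocks D S))"
    and "j\<^sub>r + 3 \<le> n"
    and "\<forall>i < j\<^sub>r + 3. pt_deg (D ! i) = i"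
    and "D ! 1 = (1, 0)"
    and "1 \<le> t" and "t \<le> t\<^sub>0"
    and "D ! (n - t) = (a, b)" and "1 \<le> a" and "1 \<le> b"
    and "D_nw = D[j\<^sub>r + 1 := (fst (D ! (j\<^sub>r + 1)) + 1, snd (D ! (j\<^sub>r + 1)) - 1),
                  n - t := (a - 1, b + 1)]"
    and "D_se = D[1 := (0, 1), n - t := (a + 1, b - 1)]"
  shows "(1 \<le> snd (D ! (j\<^sub>r + 1)) \<longrightarrow>
            equiv_mod_lower D S (2 * Delta D) (Delta D_nw + Delta D_se)) \<and>
         (\<not> minimal_block (last (blocks D S)) \<or> n - t\<^sub>0 < pt_deg (D ! (n - t)) \<longrightarrow>
            equiv_mod_lower D S (Delta D) (Delta D_se))"
proof -
  let ?L = "lower_ideal D S" and ?K = "j\<^sub>r + 1" and ?m = "n - t"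
  have L: "ideal ?L (xy_ring n)"
    unfolding lower_ideal_def assms(1)
    by (rule xy_genideal_ideal[OF lower_generators_carrier[OF assms(1)]])
  have L_incl: "f \<in> ?L" if "f \<in> low_degree_ideal n (total_deg D) \<union>
        {det S' | D' S'. length D' = n \<and> staircase_form D' S' \<and> det S' \<noteq> 0 \<and>
           lower_partition (partition_type D' S') (partition_type D S)}" for f
    unfolding lower_ideal_def assms(1)
    by (rule xy_genideal_incl[OF lower_generators_carrier[OF assms(1)] that])
  have low: "low_degree_ideal n (total_deg D) \<subseteq> ?L" using L_incl by blast
  have gen: "det S' \<in> ?L" if "length D' = n" "staircase_form D' S'" "det S' \<noteq> 0"
    "lower_partition (partition_type D' S') (partition_type D S)" for D' S'
    using L_incl that by blast
  have j2_start: "j\<^sub>r + 2 \<in> set (block_starts D)"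
    using assms(1,6,7) by (simp add: block_starts_def)
  define r where "r = last (block_starts D)"
  have r_in: "r \<in> set (block_starts D)"
    unfolding r_def using j2_start by (intro last_in_set) auto
  then have r: "r < n" "pt_deg (D ! r) = r" by (auto simp: block_starts_def assms(1))
  have r_max: "j \<le> r" if "j < n" "pt_deg (D ! j) = j" for j
  proof -
    have "sorted (block_starts D)" by (simp add: block_starts_def sorted_wrt_filter)
    moreover have "j \<in> set (block_starts D)" using that by (simp add: block_starts_def assms(1))
    ultimately show ?thesis
      unfolding r_def by (cases "block_starts D" rule: rev_cases) (auto simp: sorted_append)
  qed
  have "block_starts D \<noteq> []" using j2_start by auto
  from last_block[OF this, of S]
  have lastB: "last (blocks D S) = mat (n - r) (n - r) (\<lambda>(i, j). S $$ (r + i, r + j))"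
    by (simp add: r_def assms(1))
  have t0: "t\<^sub>0 = n - r" using assms(4) lastB by simp
  have jr: "(\<Sum>j = r..<n. j - pt_deg (D ! j)) = j\<^sub>r"
    using nonzeros_above_diag_block[OF assms(3) r(2), of n] assms(1,5) lastB by simp
  have m: "r \<le> ?m" "?m < n" using assms(9,10) t0 r by auto
  have jr_r: "j\<^sub>r + 2 \<le> r" using r_max[of "j\<^sub>r + 2"] assms(6,7) by simp
  have head: "pt_deg (D ! i) = i" if "i \<le> j\<^sub>r + 2" for i using assms(7) that by simp
  define q where "q = (a, b - 1)"
  have q: "D ! ?m = padd (0, 1) q" using assms(11-13) by (simp add: q_def padd_def)
  have se: "D_se = D[1 := (0, 1), ?m := padd (1, 0) q]"
    using assms(15) by (simp add: q_def padd_def)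
  have deg_se: "map pt_deg D_se = map pt_deg D"
    using assms(1,8,11-13,15) m jr_r
    by (intro nth_equalityI) (auto simp: nth_list_update)
  have all_low: "Delta F \<in> ?L" if j: "j < n" "j < pt_deg (D ! j)" and F: "map pt_deg F = map pt_deg D" for F j
  proof -
    have len: "length F = n" using F assms(1) by (metis length_map)
    then have "pt_deg (F ! j) = pt_deg (D ! j)"
      using F j assms(1) by (metis nth_map)
    then have "Delta F \<in> low_degree_ideal n (total_deg F)"
      using j F len assms(2) by (intro Delta_low_if_above_staircase[of _ n j]) auto
    then show ?thesis using low F by (auto simp: total_deg_def)
  qed
  have lt: "pt_deg (D ! j) < j" if "r < j" "j < n" "\<forall>j<n. pt_deg (D ! j) \<le> j" for j
    using that r_max[OF that(2)] by force
  \<comment> \<open>The point with index \<open>j\<^sub>r + 1\<close> raised by \<open>q\<close> is the same whether the trade starts from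
    \<open>D\<close> (fact 1) or from \<open>D_nw\<close> (fact 2), so the terms that keep the partition type cancel. The trade takes
    \<open>D_nw\<close> to a sequence that differs from \<open>D\<close> by a trade inside the initial chain (fact 3).\<close>
  have part_a: "2 * Delta D - (Delta D_nw + Delta D_se) \<in> ?L" if nw: "1 \<le> snd (D ! ?K)"
  proof -
    note D_nw = assms(14)
    obtain c d where K: "D ! ?K = (c, d)" by (cases "D ! ?K")
    \<comment> \<open>For \<open>j\<^sub>r = 0\<close> the point to be moved would be \<open>(1, 0)\<close>, which has no y-factor.\<close>
    have jr1: "1 \<le> j\<^sub>r" using nw assms(8) by (cases j\<^sub>r) auto
    have nw_eq: "D_nw = D[?K := (c + 1, d - 1), ?m := (a - 1, b + 1)]"
      using D_nw K by simp
    have len_nw: "length D_nw = n" using nw_eq assms(1) by simp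
    have deg_nw_nth: "pt_deg (D_nw ! j) = pt_deg (D ! j)" if "j < n" for j
      using that assms(1,11-13) nw K m jr_r by (auto simp: nw_eq nth_list_update)
    then have deg_nw: "map pt_deg D_nw = map pt_deg D"
      using len_nw assms(1) by (intro nth_equalityI) auto
    then have total_nw: "total_deg D_nw = total_deg D" by (simp add: total_deg_def)
    show ?thesis
    proof (cases "\<forall>j<n. pt_deg (D ! j) \<le> j")
      case False
      then obtain j where j: "j < n" "j < pt_deg (D ! j)" by (auto simp: not_le)
      from xy_ideal_diff[OF L xy_ideal_add[OF L all_low[OF j refl] all_low[OF j refl]]
          xy_ideal_add[OF L all_low[OF j deg_nw] all_low[OF j deg_se]]]
      show ?thesis by (simp only: mult_2)
    next
      case True
      then have le: "pt_deg (D ! j) \<le> j" if "j < n" for j using that by simp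
      have lt: "pt_deg (D ! j) < j" if "r < j" "j < n" for j
        using lt[OF that True] .
      have ptype: "partition_type D S = block_sums (\<lambda>j. j - pt_deg (D ! j)) 0 n"
        using partition_type_block_sums[OF assms(3)] le assms(1) by simp
      also have "\<dots> = block_sums (\<lambda>j. j - pt_deg (D_nw ! j)) 0 n"
        by (rule block_sums_cong) (simp add: deg_nw_nth)
      finally have gen_nw: "det S' \<in> ?L" if "length D' = n" "staircase_form D' S'" "det S' \<noteq> 0"
        "lower_partition (partition_type D' S') (block_sums (\<lambda>j. j - pt_deg (D_nw ! j)) 0 n)" for D' S'
        using gen that by simp
      have 1: "Delta D - Delta D_se + Delta (D[?m := (0, 1), ?K := padd (D ! ?K) q]) \<in> ?L"
        unfolding se
        by (rule trade_with_last_block(1)[OF assms(1,2) le r lt jr head jr_r jr1 assms(8) L low gen m q])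
          (simp add: ptype)+
      define p where "p = (a - 1, b)"
      have p: "D_nw ! ?m = padd (0, 1) p"
        using m assms(1) by (simp add: nw_eq p_def padd_def)
      have nw1: "D_nw ! 1 = (1, 0)"
        using jr1 m jr_r assms(8) by (simp add: nw_eq)
      have "Delta D_nw - Delta (D_nw[1 := (0, 1), ?m := padd (1, 0) p])
          + Delta (D_nw[?m := (0, 1), ?K := padd (D_nw ! ?K) p]) \<in> ?L"
      proof (rule trade_with_last_block(1)[OF len_nw, of r "j\<^sub>r" ?L ?m p])
        show "sorted (map pt_deg D_nw)" using assms(2) deg_nw by simp
        show "pt_deg (D_nw ! j) \<le> j" if "j < n" for j using le[OF that] deg_nw_nth[OF that] by simp
        show "pt_deg (D_nw ! r) = r" using r deg_nw_nth by simp
        show "pt_deg (D_nw ! j) < j" if "r < j" "j < n" for j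
          using lt[OF that] deg_nw_nth[OF that(2)] by simp
        show "(\<Sum>j = r..<n. j - pt_deg (D_nw ! j)) = j\<^sub>r"
          unfolding jr[symmetric] by (rule sum.cong) (simp_all add: deg_nw_nth)
        show "pt_deg (D_nw ! i) = i" if "i \<le> j\<^sub>r + 2" for i
          using head[OF that] deg_nw_nth[of i] that jr_r r(1) by simp
        show "low_degree_ideal n (total_deg D_nw) \<subseteq> ?L" using low total_nw by simp
      qed (fact r(1) jr_r jr1 nw1 L gen_nw m p)+
      moreover have "D_nw[?m := (0, 1), ?K := padd (D_nw ! ?K) p] = D[?m := (0, 1), ?K := padd (D ! ?K) q]"
        using m jr_r nw K assms(1,12,13)
        by (intro nth_equalityI) (auto simp: nw_eq nth_list_update padd_def p_def q_def)
      moreover have "D_nw[1 := (0, 1), ?m := padd (1, 0) p] = D[1 := (0, 1), ?K := (c + 1, d - 1)]"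
        using m jr_r jr1 assms(1,11-13)
        by (intro nth_equalityI) (auto simp: nw_eq nth_list_update padd_def p_def)
      ultimately have 2: "Delta D_nw - Delta (D[1 := (0, 1), ?K := (c + 1, d - 1)])
          + Delta (D[?m := (0, 1), ?K := padd (D ! ?K) q]) \<in> ?L" by simp
      have "D ! ?K = padd (0, 1) (c, d - 1)" using nw K by (simp add: padd_def)
      from trade_in_chain_low[OF assms(1,2) le r lt jr head jr_r jr1 assms(8) this]
      have 3: "Delta D - Delta (D[1 := (0, 1), ?K := (c + 1, d - 1)]) \<in> ?L"
        using low by (auto simp: padd_def)
      from xy_ideal_add[OF L xy_ideal_diff[OF L 1 2] 3] show ?thesis
        by (simp add: algebra_simps mult_2)
    qed
  qed
  have part_b: "Delta D - Delta D_se \<in> ?L"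
    if b: "\<not> minimal_block (last (blocks D S)) \<or> r < pt_deg (D ! ?m)"
  proof (cases "\<forall>j<n. pt_deg (D ! j) \<le> j")
    case False
    then obtain j where j: "j < n" "j < pt_deg (D ! j)" by (auto simp: not_le)
    from xy_ideal_diff[OF L all_low[OF j refl] all_low[OF j deg_se]] show ?thesis .
  next
    case True
    then have le: "pt_deg (D ! j) \<le> j" if "j < n" for j using that by simp
    have lt: "pt_deg (D ! j) < j" if "r < j" "j < n" for j
      using lt[OF that True] .
    have ptype: "partition_type D S = block_sums (\<lambda>j. j - pt_deg (D ! j)) 0 n"
      using partition_type_block_sums[OF assms(3)] le assms(1) by simp
    have excess: "0 < j - pt_deg (D ! j)" if "r < j" "j < n" for j using lt[OF that] by simp
    have r_deg: "r \<le> pt_deg (D ! ?m)"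
      using sorted_nth_mono[OF assms(2) m(1)] m r assms(1) by simp
    have "n \<le> j\<^sub>r + pt_deg (D ! ?m) \<and> 1 \<le> j\<^sub>r"
      using b
    proof
      assume "\<not> minimal_block (last (blocks D S))"
      then obtain i j where ij: "j < n - r" "i + 1 < j" "S $$ (r + i, r + j) \<noteq> 0"
        unfolding minimal_block_def lastB by auto
      then have "pt_deg (D ! (r + j)) \<le> r + i"
        using staircase_entry_nonzero_iff[OF assms(3), of "r + i" "r + j"] assms(1) by auto
      then have "n \<le> j\<^sub>r + r"
        using sum_excess_ge(2)[of r n "\<lambda>j. j - pt_deg (D ! j)" "r + j"] excess r ij jr by auto
      then show ?thesis using r r_deg by simp
    next
      assume "r < pt_deg (D ! ?m)"
      moreover have "n \<le> j\<^sub>r + r + 1"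
        using sum_excess_ge(1)[of r n "\<lambda>j. j - pt_deg (D ! j)"] excess r jr by auto
      ultimately show ?thesis using le[OF m(2)] m by simp
    qed
    then have b': "n \<le> j\<^sub>r + pt_deg (D ! ?m)" and jr1: "1 \<le> j\<^sub>r" by auto
    show ?thesis
      unfolding se
      by (rule trade_with_last_block(2)[OF assms(1,2) le r lt jr head jr_r jr1 assms(8) L low gen m q b'])
        (simp add: ptype)+
  qed
  show ?thesis using part_a part_b t0 r by (simp add: equiv_mod_lower_def)
qed

end
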